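(* Let $f=(f_n)_{n\in\mathbb{N}}$ be an arbitrary family of Boolean functions $f_n:\{0,1\}^n\times\{0,1\}^n\to\{0,1\}$. Then there is a computable time bound $t:\mathbb{N}\to\mathbb{N}$ and a constant $c$ (independent of $n$) such that for every $n$, $$\Bigl|\,N^1(f_n) - \max_{x,y\in\{0,1\}^n}\text{\rm ic}_\text{\rm yes}^{f,t}\bigl(y:Y_1(x)\bigr)\Bigr|\le c .$$
   Context: Communication setting: Alice holds $\overline{x}\in\{0,1\}^n$, Bob holds $\overline{y}\in\{0,1\}^n$, both know $f_n$ and have unbounded computational power. A one-sided non-deterministic protocol $P$ with output set $\{1,\bot\}$ for $f_n$ receives a guess $w$ (given to both players, untrusted), and the players exchange bits (the conversation $c(w)$) and output $1$ or $\bot$, such that: if $f_n(\overline{x},\overline{y})=1$ then there exists $w$ with $P(w,\overline{x},\overline{y})=1$; if $f_n(\overline{x},\overline{y})\neq 1$ then $P(w,\overline{x},\overline{y})=\bot$ for all $w$. For $(\overline{x},\overline{y})$ with $f_n(\overline{x},\overline{y})=1$ let $\mathcal{N}^1_P(f_n,\overline{x},\overline{y})=\min_w\{|c(w)| : P(w,\overline{x},\overline{y})=1\}$; $N^1_P(f_n)=\max_{\overline{x},\overline{y}}\mathcal{N}^1_P(f_n,\overline{x},\overline{y})$ (maximum over pairs with $f_n(\overline{x},\overline{y})=1$); and $N^1(f_n)=\min_P N^1_P(f_n)$ over all such protocols. For $x\in\{0,1\}^n$, $Y_1(x)=\{y\in\{0,1\}^n : f_n(x,y)=1\}$. Instance complexity: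 programs are for a fixed universal machine and may query an oracle $f$ which, on inputs of length $n$, provides the description (truth table) of $f_n$. A program $p$ is consistent with a set $A$ if $p(y)=1$ implies $y\in A$ and $p(y)=0$ implies $y\notin A$. For a time bound $t$, a set $A$ and an element $x$, $\text{\rm ic}_\text{\rm yes}^{f,t}(x:A)$ is the minimum length $|p|$ of a total program $p$ with oracle access to $f$ such that: (C1) for all $y$, $p(y)$ runs in at most $t(|y|)$ steps; (C2) for all $y$, $p(y)\in\{1,\bot\}$; (C3) $p$ is consistent with $A$; (C4) if $x\in A$ then $p(x)=1$.
   Formalization: The cost |c(w)| counts the guess w as well as the exchanged bits, the guesses of a protocol form a prefix-free set, and consistency (C3) is required only for y of length n; with free guesses (equality) or consistency over all lengths (f constant 1) the claim is false. *)

theory Defs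
  imports Complex_Main "HOL-Library.Extended_Real" "HOL-Library.Sublist"
begin

text \<open>
  Elements of \<open>{0,1}\<^sup>n\<close> are boolean lists of length \<open>n\<close>.  A family of Boolean functions is
  \<open>f :: nat \<Rightarrow> bool list \<Rightarrow> bool list \<Rightarrow> bool\<close>; the values \<open>f n x y\<close> are only ever used for
  \<open>x\<close> and \<open>y\<close> of length \<open>n\<close>.
\<close>

definition cube :: "nat \<Rightarrow> bool list set" where
  "cube n = {x. length x = n}"

definition Y1 :: "(nat \<Rightarrow> bool list \<Rightarrow> bool list \<Rightarrow> bool) \<Rightarrow> nat \<Rightarrow> bool list \<Rightarrow> bool list set" where
  "Y1 f n x = {y \<in> cube n. f n x y}"


section \<open>One-sided non-deterministic protocols\<close>

text \<open>
  Bit exchange for a fixed guess.  The owner of a node sends the indicated bit of its own input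
  (\<open>True\<close> leads to the first subtree); both players know the exchanged bits, hence the node
  reached, and a leaf carries the output: \<open>True\<close> for \<open>1\<close> and \<open>False\<close> for \<open>\<bottom>\<close>.
\<close>

datatype exchange =
    Output bool
  | Alice "bool list \<Rightarrow> bool" exchange exchange
  | Bob "bool list \<Rightarrow> bool" exchange exchange

primrec exchange_output :: "exchange \<Rightarrow> bool list \<Rightarrow> bool list \<Rightarrow> bool" where
  "exchange_output (Output b) x y = b"
| "exchange_output (Alice g T F) x y =
     (if g x then exchange_output T x y else exchange_output F x y)"
| "exchange_output (Bob g T F) x y =
     (if g y then exchange_output T x y else exchange_output F x y)"

primrec exchange_bits :: "exchange \<Rightarrow> bool list \<Rightarrow> bool list \<Rightarrow> bool list" where
  "exchange_bits (Output b) x y = []"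
| "exchange_bits (Alice g T F) x y =
     g x # (if g x then exchange_bits T x y else exchange_bits F x y)"
| "exchange_bits (Bob g T F) x y =
     g y # (if g y then exchange_bits T x y else exchange_bits F x y)"

text \<open>
  The guess is a bit string handed to both players, so the exchange that follows may depend on it
  in any way.  The conversation is everything communicated in the run, starting with the
  announcement of the guess.  If the guess were free of charge, every function would have a
  protocol of cost 2: guess \<open>(x, y)\<close> and let each player confirm its own half with one bit.
  The possible guesses form a prefix-free set (for instance, all strings of some fixed length), so
  that, as usual for protocols, the conversation itself determines where the guess ends; no
  information is conveyed by the end of a message.
\<close>

record protocol =
  guesses :: "bool list set"
  exch :: "bool list \<Rightarrow> exchange"

definition prefix_free :: "bool list set \<Rightarrow> bool" where
  "prefix_free W \<longleftrightarrow> (\<forall>u\<in>W. \<forall>v\<in>W. prefix u v \<longrightarrow> u = v)"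

definition accepts :: "protocol \<Rightarrow> bool list \<Rightarrow> bool list \<Rightarrow> bool list \<Rightarrow> bool" where
  "accepts P w x y \<longleftrightarrow> exchange_output (exch P w) x y"

definition conversation :: "protocol \<Rightarrow> bool list \<Rightarrow> bool list \<Rightarrow> bool list \<Rightarrow> bool list" where
  "conversation P w x y = w @ exchange_bits (exch P w) x y"

definition is_protocol_for ::
  "protocol \<Rightarrow> (nat \<Rightarrow> bool list \<Rightarrow> bool list \<Rightarrow> bool) \<Rightarrow> nat \<Rightarrow> bool" where
  "is_protocol_for P f n \<longleftrightarrow>
     prefix_free (guesses P) \<and>
     (\<forall>x\<in>cube n. \<forall>y\<in>cube n.
        (f n x y \<longrightarrow> (\<exists>w\<in>guesses P. accepts P w x y)) \<and>
        (\<not> f n x y \<longrightarrow> (\<forall>w\<in>guesses P. \<not> accepts P w x y)))"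

definition pair_cost :: "protocol \<Rightarrow> bool list \<Rightarrow> bool list \<Rightarrow> nat" where
  "pair_cost P x y = Inf {length (conversation P w x y) | w. w \<in> guesses P \<and> accepts P w x y}"

text \<open>On \<^typ>\<open>nat\<close>, \<open>Sup\<close> is the maximum of a finite set and \<open>0\<close> for the empty set, which
  fixes the cost when \<open>f n\<close> never takes the value \<open>1\<close>.\<close>

definition protocol_cost ::
  "protocol \<Rightarrow> (nat \<Rightarrow> bool list \<Rightarrow> bool list \<Rightarrow> bool) \<Rightarrow> nat \<Rightarrow> nat" where
  "protocol_cost P f n = Sup {pair_cost P x y | x y. x \<in> cube n \<and> y \<in> cube n \<and> f n x y}"

definition N1 :: "(nat \<Rightarrow> bool list \<Rightarrow> bool list \<Rightarrow> bool) \<Rightarrow> nat \<Rightarrow> nat" where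
  "N1 f n = Inf {protocol_cost P f n | P. is_protocol_for P f n}"

text \<open>The minimum is over a nonempty set: guess \<open>x\<close>, let Alice confirm it, let Bob send the value.\<close>

lemma protocol_exists: "\<exists>P. is_protocol_for P f n"
proof -
  let ?P = "\<lparr>guesses = cube n,
    exch = (\<lambda>w. Alice (\<lambda>x. x = w) (Bob (f n w) (Output True) (Output False)) (Output False))\<rparr>"
  have "is_protocol_for ?P f n"
    by (auto simp: is_protocol_for_def prefix_free_def accepts_def cube_def prefix_def)
  then show ?thesis by blast
qed


section \<open>The universal oracle machine\<close>

text \<open>
  A machine has registers \<open>0, 1, 2, \<dots>\<close> holding bit strings, used as stacks, and a structured
  finite control.  \<open>Cond\<close> tests for a leading \<open>1\<close>, \<open>Loop\<close> runs its body while the register is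
  nonempty.  \<open>Query r\<close> asks the oracle the content of register \<open>r\<close>, which is overwritten by the
  answer.  The answer depends only on the length of the question.
\<close>

datatype instr =
    Skip
  | Push nat bool
  | Pop nat
  | Query nat
  | Then instr instr
  | Cond nat instr instr
  | Loop nat instr

type_synonym state = "nat \<Rightarrow> bool list"

definition starts_with_1 :: "bool list \<Rightarrow> bool" where
  "starts_with_1 u \<longleftrightarrow> u \<noteq> [] \<and> hd u"

text \<open>\<open>exec orc c s k s'\<close>: started in \<open>s\<close>, the control \<open>c\<close> halts in \<open>s'\<close> after exactly \<open>k\<close> steps.\<close>

inductive exec :: "(nat \<Rightarrow> bool list) \<Rightarrow> instr \<Rightarrow> state \<Rightarrow> nat \<Rightarrow> state \<Rightarrow> bool"
  for orc :: "nat \<Rightarrow> bool list" where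
  exec_Skip: "exec orc Skip s 1 s"
| exec_Push: "exec orc (Push r b) s 1 (s(r := b # s r))"
| exec_Pop: "exec orc (Pop r) s 1 (s(r := tl (s r)))"
| exec_Query: "exec orc (Query r) s 1 (s(r := orc (length (s r))))"
| exec_Then: "exec orc c1 s k1 s1 \<Longrightarrow> exec orc c2 s1 k2 s2 \<Longrightarrow> exec orc (Then c1 c2) s (k1 + k2) s2"
| exec_CondT: "starts_with_1 (s r) \<Longrightarrow> exec orc c1 s k s1 \<Longrightarrow> exec orc (Cond r c1 c2) s (Suc k) s1"
| exec_CondF: "\<not> starts_with_1 (s r) \<Longrightarrow> exec orc c2 s k s1 \<Longrightarrow> exec orc (Cond r c1 c2) s (Suc k) s1"
| exec_LoopF: "s r = [] \<Longrightarrow> exec orc (Loop r c) s 1 s"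
| exec_LoopT: "s r \<noteq> [] \<Longrightarrow> exec orc c s k1 s1 \<Longrightarrow> exec orc (Loop r c) s1 k2 s2 \<Longrightarrow>
    exec orc (Loop r c) s (Suc (k1 + k2)) s2"

lemma exec_deterministic:
  "exec orc c s k s1 \<Longrightarrow> exec orc c s k' s2 \<Longrightarrow> k' = k \<and> s2 = s1"
proof (induction arbitrary: k' s2 rule: exec.induct)
  case (exec_Then c1 s k1 s1 c2 k2 s2')
  from exec_Then.prems show ?case
  proof cases
    case inner: (exec_Then k1' s1' k2')
    then show ?thesis using exec_Then.IH by metis
  qed
next
  case (exec_CondT s r c1 k s1 c2)
  from exec_CondT.prems show ?case
  proof cases
    case inner: (exec_CondT k1)
    then show ?thesis using exec_CondT.IH by metis
  next
    case inner: (exec_CondF k1)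
    then show ?thesis using exec_CondT.hyps by metis
  qed
next
  case (exec_CondF s r c2 k s1 c1)
  from exec_CondF.prems show ?case
  proof cases
    case inner: (exec_CondT k1)
    then show ?thesis using exec_CondF.hyps by metis
  next
    case inner: (exec_CondF k1)
    then show ?thesis using exec_CondF.IH by metis
  qed
next
  case (exec_LoopT s r c k1 s1 k2 s2')
  from exec_LoopT.prems show ?case
  proof cases
    case inner: exec_LoopF
    then show ?thesis using exec_LoopT.hyps by metis
  next
    case inner: (exec_LoopT k1' s1' k2')
    then show ?thesis using exec_LoopT.IH by metis
  qed
qed (erule exec.cases; simp)+

text \<open>
  Oracle-free machines define the computable functions; arguments and values are written in unary.
\<close>

primrec oracle_free :: "instr \<Rightarrow> bool" where
  "oracle_free Skip \<longleftrightarrow> True"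
| "oracle_free (Push r b) \<longleftrightarrow> True"
| "oracle_free (Pop r) \<longleftrightarrow> True"
| "oracle_free (Query r) \<longleftrightarrow> False"
| "oracle_free (Then c1 c2) \<longleftrightarrow> oracle_free c1 \<and> oracle_free c2"
| "oracle_free (Cond r c1 c2) \<longleftrightarrow> oracle_free c1 \<and> oracle_free c2"
| "oracle_free (Loop r c) \<longleftrightarrow> oracle_free c"

definition computable :: "(nat \<Rightarrow> nat) \<Rightarrow> bool" where
  "computable t \<longleftrightarrow> (\<exists>c. oracle_free c \<and>
     (\<forall>n. \<exists>k s. exec (\<lambda>_. []) c ((\<lambda>_. [])(0 := replicate n True)) k s \<and>
       s 2 = replicate (t n) True))"

text \<open>
  A program for the universal machine is a bit string: the self-delimiting code of a machine,
  followed by arbitrary data for that machine.  So the universal machine simulates every machine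
  with a constant additive overhead in program length, and program length is measured in bits.
\<close>

definition code_nat :: "nat \<Rightarrow> bool list" where
  "code_nat n = replicate n True @ [False]"

primrec code :: "instr \<Rightarrow> bool list" where
  "code Skip = [False, False, False]"
| "code (Push r b) = [False, False, True, b] @ code_nat r"
| "code (Pop r) = [False, True, False] @ code_nat r"
| "code (Query r) = [False, True, True] @ code_nat r"
| "code (Then c1 c2) = [True, False, False] @ code c1 @ code c2"
| "code (Cond r c1 c2) = [True, False, True] @ code_nat r @ code c1 @ code c2"
| "code (Loop r c) = [True, True, False] @ code_nat r @ code c"

lemma code_nat_append_eq_iff [simp]:
  "code_nat m @ u = code_nat n @ v \<longleftrightarrow> m = n \<and> u = v"
proof (induction m arbitrary: n)
  case 0
  then show ?case by (cases n) (auto simp: code_nat_def)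
next
  case (Suc m)
  then show ?case by (cases n) (auto simp: code_nat_def)
qed

lemma code_append_eq_iff: "code c @ u = code c' @ v \<longleftrightarrow> c = c' \<and> u = v"
proof (induction c arbitrary: c' u v)
  case (Then c1 c2)
  then show ?case by (cases c') auto
next
  case (Cond r c1 c2)
  then show ?case by (cases c') auto
next
  case (Loop r c)
  then show ?case by (cases c') auto
qed (case_tac c'; auto)+

text \<open>
  The input is placed in register 0, the data in register 1, and the output is read off
  register 2.  A bit string without a machine code as prefix never halts.
\<close>

datatype answer = Yes | No | Dont_know

definition answer_of :: "bool list \<Rightarrow> answer" where
  "answer_of u = (if u = [] then Dont_know else if hd u then Yes else No)"

definition truth_table :: "(nat \<Rightarrow> bool list \<Rightarrow> bool list \<Rightarrow> bool) \<Rightarrow> nat \<Rightarrow> bool list" where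
  "truth_table f n =
     [f n x y. x \<leftarrow> List.n_lists n [False, True], y \<leftarrow> List.n_lists n [False, True]]"

definition runs ::
  "(nat \<Rightarrow> bool list \<Rightarrow> bool list \<Rightarrow> bool) \<Rightarrow> bool list \<Rightarrow> bool list \<Rightarrow> nat \<Rightarrow> answer \<Rightarrow> bool" where
  "runs f p y k a \<longleftrightarrow> (\<exists>c d s. p = code c @ d \<and>
     exec (truth_table f) c ((\<lambda>_. [])(0 := y, 1 := d)) k s \<and> a = answer_of (s 2))"

lemma runs_deterministic: "runs f p y k a \<Longrightarrow> runs f p y k' a' \<Longrightarrow> k' = k \<and> a' = a"
  unfolding runs_def by (metis code_append_eq_iff exec_deterministic)

definition outputs ::
  "(nat \<Rightarrow> bool list \<Rightarrow> bool list \<Rightarrow> bool) \<Rightarrow> bool list \<Rightarrow> bool list \<Rightarrow> answer \<Rightarrow> bool" where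
  "outputs f p y a \<longleftrightarrow> (\<exists>k. runs f p y k a)"


section \<open>Instance complexity\<close>

text \<open>
  Sets \<open>A\<close> whose instance complexity is considered here consist of strings of one length \<open>n\<close>, and
  consistency is required on \<^term>\<open>cube n\<close>.  (Over all strings it would force a program that
  answers \<open>1\<close> somewhere to encode \<open>n\<close>.)
\<close>

definition consistent ::
  "(nat \<Rightarrow> bool list \<Rightarrow> bool list \<Rightarrow> bool) \<Rightarrow> nat \<Rightarrow> bool list \<Rightarrow> bool list set \<Rightarrow> bool" where
  "consistent f n p A \<longleftrightarrow>
     (\<forall>y\<in>cube n. (outputs f p y Yes \<longrightarrow> y \<in> A) \<and> (outputs f p y No \<longrightarrow> y \<notin> A))"

definition ic_program ::
  "(nat \<Rightarrow> bool list \<Rightarrow> bool list \<Rightarrow> bool) \<Rightarrow> (nat \<Rightarrow> nat) \<Rightarrow> nat \<Rightarrow> bool list \<Rightarrow> bool list set \<Rightarrow>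
    bool list \<Rightarrow> bool" where
  "ic_program f t n x A p \<longleftrightarrow>
     (\<forall>y. \<exists>k a. runs f p y k a \<and> k \<le> t (length y)) \<and>
     (\<forall>y. outputs f p y Yes \<or> outputs f p y Dont_know) \<and>
     consistent f n p A \<and>
     (x \<in> A \<longrightarrow> outputs f p x Yes)"

text \<open>The value is \<open>\<infinity>\<close> if there is no such program.\<close>

definition ic_yes ::
  "(nat \<Rightarrow> bool list \<Rightarrow> bool list \<Rightarrow> bool) \<Rightarrow> (nat \<Rightarrow> nat) \<Rightarrow> nat \<Rightarrow> bool list \<Rightarrow> bool list set \<Rightarrow>
    enat" where
  "ic_yes f t n x A = Inf {enat (length p) | p. ic_program f t n x A p}"

end

theory Submission
  imports Defs
begin

text \<open>
  An accepting conversation determines a rectangle of 1-entries, and accepting conversations form a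
  prefix-free set.  Padding them to length \<open>k = N1 f n\<close> yields \<open>2\<^sup>k\<close> sets of columns such that every
  \<open>Y1 f n x\<close> is a union of some of them.  One fixed machine, which obtains the truth table from the
  oracle, finds the first family of \<open>2\<^sup>k\<close> sets with this property by exhaustive search, and its data
  (\<open>k\<close> bits and an end marker) select a member of the family; so a program of length \<open>k + O(1)\<close>
  certifies any given \<open>y \<in> Y1 f n x\<close>.  Conversely, the players can guess a certifying program of
  length at most \<open>m\<close>, padded to \<open>m + 1\<close> bits; Alice confirms with one bit that it is consistent with
  \<open>Y1 f n x\<close>, Bob with one bit that it accepts \<open>y\<close>.

  The time bound need only be computable.  The search is primitive recursive, hence bounded by a
  level of a fast-growing hierarchy, and each level is itself primitive recursive.
\<close>

section \<open>Machines with running time in the fast-growing hierarchy\<close>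

text \<open>With \<open>m + 2\<close> rounds, at least two are made even for \<open>m = 0\<close>.
  So one level up absorbs the composition of two bounds, and also a loop of at most \<open>m\<close>
  rounds with an application to spare.\<close>

primrec growth :: "nat \<Rightarrow> nat \<Rightarrow> nat" where
  "growth 0 = Suc"
| "growth (Suc j) = (\<lambda>m. (growth j ^^ (m + 2)) m)"

lemma funpow_increasing:
  fixes g :: "nat \<Rightarrow> nat"
  assumes "\<And>m. m \<le> g m" and "a \<le> b"
  shows "(g ^^ a) m \<le> (g ^^ b) m"
  using assms(2)
proof (induction rule: dec_induct)
  case (step i)
  then show ?case using assms(1)[of "(g ^^ i) m"] by simp
qed simp

lemma growth_gt: "m < growth j m"
proof (induction j arbitrary: m)
  case (Suc j)
  have "(growth j ^^ 1) m \<le> (growth j ^^ (m + 2)) m"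
    using Suc by (intro funpow_increasing) (simp_all add: less_imp_le)
  then show ?case using Suc[of m] by simp
qed simp

lemma growth_ge: "m \<le> growth j m"
  using growth_gt less_imp_le by blast

lemma growth_mono: "m \<le> m' \<Longrightarrow> growth j m \<le> growth j m'"
proof (induction j arbitrary: m m')
  case (Suc j)
  have "mono (growth j)" using Suc.IH by (rule monoI)
  then have "(growth j ^^ (m + 2)) m \<le> (growth j ^^ (m + 2)) m'"
    using Suc.prems by (rule funpow_mono)
  also have "\<dots> \<le> (growth j ^^ (m' + 2)) m'"
    using Suc.prems by (intro funpow_increasing growth_ge) simp
  finally show ?case by (simp del: funpow.simps)
qed simp

lemma growth_twice_le: "growth j (growth j m) \<le> growth (Suc j) m"
  using funpow_increasing[of "growth j" 2 "m + 2" m] growth_ge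
  by (simp add: numeral_2_eq_2)

lemma growth_Suc_le: "growth j m \<le> growth (Suc j) m"
  using growth_twice_le growth_ge le_trans by blast

lemma growth_le: "i \<le> j \<Longrightarrow> growth i m \<le> growth j m"
  by (rule lift_Suc_mono_le[of "\<lambda>j. growth j m"]) (rule growth_Suc_le)

declare growth.simps(2) [simp del]

text \<open>Needed for oracle answers, which have \<open>4 ^ n\<close> bits for a question of length
  \<open>n\<close>. Level 1 is \<open>2 * m + 2\<close>; iterating it brings level 2 above
  \<open>2 ^ m\<close>; level 2 applied twice exceeds \<open>2 ^ (2 * m)\<close>.\<close>

lemma power_le_growth: "4 ^ m \<le> growth 3 m"
proof -
  have g1: "growth (Suc 0) m = 2 * m + 2" for m
  proof -
    have "(Suc ^^ k) m = m + k" for k by (induction k) auto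
    then show ?thesis by (simp add: growth.simps(2) del: funpow.simps)
  qed
  have "2 ^ k \<le> (growth (Suc 0) ^^ Suc k) m" for k m
    by (induction k) (auto simp: g1)
  then have g2: "2 ^ m \<le> growth 2 m" for m
    using le_trans[OF _ funpow_increasing[of "growth (Suc 0)" "Suc m" "m + 2" m]] growth_ge
    by (simp add: numeral_2_eq_2 growth.simps(2)[of "Suc 0"] del: funpow.simps)
  have "(4::nat) ^ m = 2 ^ (2 * m)" by (simp add: power_mult)
  also have "\<dots> \<le> 2 ^ growth 2 m"
    using growth_le[of "Suc 0" 2 m] by (intro power_increasing) (auto simp: g1)
  also have "\<dots> \<le> growth 2 (growth 2 m)" by (rule g2)
  also have "\<dots> \<le> growth 3 m" using growth_twice_le[of 2 m] by (simp add: numeral_3_eq_3)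
  finally show ?thesis .
qed

text \<open>Register \<open>1\<close> is exempt: it holds the data, whose length is not bounded in terms of the input.\<close>

definition fits :: "nat \<Rightarrow> state \<Rightarrow> nat \<Rightarrow> bool" where
  "fits m s T \<longleftrightarrow> (\<forall>i. i \<noteq> 1 \<longrightarrow> length (s i) \<le> m) \<and> T \<le> m"

lemma fits_mono: "fits m s T \<Longrightarrow> m \<le> m' \<Longrightarrow> fits m' s T"
  unfolding fits_def using le_trans by blast

text \<open>\<open>T\<close> is a clock: letting it start at an arbitrary value makes space and time bounds compose.\<close>

definition realizes_at :: "(nat \<Rightarrow> bool list) \<Rightarrow> nat \<Rightarrow> instr \<Rightarrow> (state \<Rightarrow> state \<Rightarrow> bool) \<Rightarrow> bool" where
  "realizes_at orc j c R \<longleftrightarrow> (\<forall>s.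
     (\<exists>k s'. exec orc c s k s' \<and> R s s' \<and>
        (\<forall>m T. fits m s T \<longrightarrow> fits (growth j m) s' (T + k))))"

text \<open>The level is uniform in the start state, but its value is hidden: a computable time
  bound needs only some level, and the rules below then compose without arithmetic.\<close>

definition realizes :: "(nat \<Rightarrow> bool list) \<Rightarrow> instr \<Rightarrow> (state \<Rightarrow> state \<Rightarrow> bool) \<Rightarrow> bool" where
  "realizes orc c R \<longleftrightarrow> (\<exists>j. realizes_at orc j c R)"

lemma realizes_atE:
  assumes "realizes_at orc j c R"
  obtains k s' where "exec orc c s k s'" "R s s'"
    "\<And>m T. fits m s T \<Longrightarrow> fits (growth j m) s' (T + k)"
  using assms unfolding realizes_at_def by metis

lemma realizes_at_mono:
  assumes "realizes_at orc i c R" "i \<le> j"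
  shows "realizes_at orc j c R"
  unfolding realizes_at_def
proof
  fix s
  from assms(1) obtain k s' where "exec orc c s k s'" "R s s'"
    "\<And>m T. fits m s T \<Longrightarrow> fits (growth i m) s' (T + k)"
    by (metis realizes_atE)
  then show "\<exists>k s'. exec orc c s k s' \<and> R s s' \<and>
      (\<forall>m T. fits m s T \<longrightarrow> fits (growth j m) s' (T + k))"
    using growth_le[OF assms(2)] fits_mono by blast
qed

lemma realizes_weaken:
  assumes "realizes orc c R" "\<And>s s'. R s s' \<Longrightarrow> R' s s'"
  shows "realizes orc c R'"
  using assms unfolding realizes_def realizes_at_def by meson

section \<open>Resource bounds for instructions and control structures\<close>

lemma realizes_Skip: "realizes orc Skip (\<lambda>s s'. s' = s)"
  unfolding realizes_def realizes_at_def
  by (rule exI[of _ 0]) (auto simp: fits_def le_Suc_eq intro!: exec_Skip exI)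

lemma realizes_Push: "realizes orc (Push r b) (\<lambda>s s'. s' = s(r := b # s r))"
  unfolding realizes_def realizes_at_def
  by (rule exI[of _ 0]) (auto simp: fits_def le_SucI intro!: exec_Push exI)

lemma realizes_Pop: "realizes orc (Pop r) (\<lambda>s s'. s' = s(r := tl (s r)))"
  unfolding realizes_def realizes_at_def
  by (rule exI[of _ 0]) (auto simp: fits_def le_SucI le_diff_conv intro!: exec_Pop exI)

text \<open>Both parts are lifted to a common level. The bound reached by \<open>c1\<close>, clock
  included, is the starting bound of \<open>c2\<close>; the resulting nested application is covered
  by one more level.\<close>

lemma realizes_Then:
  assumes "realizes orc c1 R1" "realizes orc c2 R2"
  shows "realizes orc (Then c1 c2) (R1 OO R2)"
proof -
  from assms obtain j1 j2 where "realizes_at orc j1 c1 R1" "realizes_at orc j2 c2 R2"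
    unfolding realizes_def by blast
  then have at: "realizes_at orc (max j1 j2) c1 R1" "realizes_at orc (max j1 j2) c2 R2"
    by (auto elim: realizes_at_mono)
  have "realizes_at orc (Suc (max j1 j2)) (Then c1 c2) (R1 OO R2)"
    unfolding realizes_at_def
  proof
    fix s
    from realizes_atE[OF at(1), of s] obtain k1 s1 where 1: "exec orc c1 s k1 s1" "R1 s s1"
      "\<And>m T. fits m s T \<Longrightarrow> fits (growth (max j1 j2) m) s1 (T + k1)" by blast
    from realizes_atE[OF at(2), of s1] obtain k2 s2 where 2: "exec orc c2 s1 k2 s2" "R2 s1 s2"
      "\<And>m T. fits m s1 T \<Longrightarrow> fits (growth (max j1 j2) m) s2 (T + k2)" by blast
    have "fits (growth (Suc (max j1 j2)) m) s2 (T + (k1 + k2))" if "fits m s T" for m T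
      using fits_mono[OF 2(3)[OF 1(3)[OF that]] growth_twice_le] by (simp add: add.assoc)
    then show "\<exists>k s'. exec orc (Then c1 c2) s k s' \<and> (R1 OO R2) s s' \<and>
        (\<forall>m T. fits m s T \<longrightarrow> fits (growth (Suc (max j1 j2)) m) s' (T + k))"
      using exec_Then[OF 1(1) 2(1)] 1(2) 2(2) by blast
  qed
  then show ?thesis unfolding realizes_def by blast
qed

text \<open>Pays for the single step of a test: starting with bound and clock raised by one costs at
  most one level.\<close>

lemma growth_Suc_arg_le: "growth j (Suc m) \<le> growth (Suc j) m"
  using growth_mono[of "Suc m" "growth j m" j] growth_gt[of m j] growth_twice_le[of j m]
  by (meson Suc_leI le_trans)

lemma fits_Suc: "fits m s T \<Longrightarrow> fits (Suc m) s (Suc T)"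
  by (simp add: fits_def le_SucI)

lemma realizes_Cond:
  assumes "realizes orc c1 R1" "realizes orc c2 R2"
  shows "realizes orc (Cond r c1 c2) (\<lambda>s s'. if starts_with_1 (s r) then R1 s s' else R2 s s')"
proof -
  from assms obtain j1 j2 where "realizes_at orc j1 c1 R1" "realizes_at orc j2 c2 R2"
    unfolding realizes_def by blast
  then have at: "realizes_at orc (max j1 j2) c1 R1" "realizes_at orc (max j1 j2) c2 R2"
    by (auto elim: realizes_at_mono)
  have "realizes_at orc (Suc (max j1 j2)) (Cond r c1 c2)
      (\<lambda>s s'. if starts_with_1 (s r) then R1 s s' else R2 s s')"
    unfolding realizes_at_def
  proof
    fix s
    from realizes_atE[OF at(1), of s] obtain k1 s1 where 1: "exec orc c1 s k1 s1" "R1 s s1"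
      "\<And>m T. fits m s T \<Longrightarrow> fits (growth (max j1 j2) m) s1 (T + k1)" by blast
    from realizes_atE[OF at(2), of s] obtain k2 s2 where 2: "exec orc c2 s k2 s2" "R2 s s2"
      "\<And>m T. fits m s T \<Longrightarrow> fits (growth (max j1 j2) m) s2 (T + k2)" by blast
    have "fits (growth (Suc (max j1 j2)) m) s1 (T + Suc k1)" if "fits m s T" for m T
      using fits_mono[OF 1(3)[OF fits_Suc[OF that]] growth_Suc_arg_le] by simp
    moreover have "fits (growth (Suc (max j1 j2)) m) s2 (T + Suc k2)" if "fits m s T" for m T
      using fits_mono[OF 2(3)[OF fits_Suc[OF that]] growth_Suc_arg_le] by simp
    ultimately show "\<exists>k s'. exec orc (Cond r c1 c2) s k s' \<and>
        (if starts_with_1 (s r) then R1 s s' else R2 s s') \<and>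
        (\<forall>m T. fits m s T \<longrightarrow> fits (growth (Suc (max j1 j2)) m) s' (T + k))"
      using exec_CondT[OF _ 1(1), of r c2] exec_CondF[OF _ 2(1), of r c1] 1(2) 2(2)
      by (metis (full_types))
  qed
  then show ?thesis unfolding realizes_def by blast
qed

text \<open>The question must have length at most \<open>m\<close>, which \<open>fits\<close> does
  not guarantee for register 1; the answer then has at most \<open>4 ^ m\<close> bits.\<close>

lemma realizes_Query:
  assumes "r \<noteq> 1" and orc: "\<And>n. length (orc n) \<le> 4 ^ n"
  shows "realizes orc (Query r) (\<lambda>s s'. s' = s(r := orc (length (s r))))"
proof -
  have "length (orc (length (s r))) \<le> growth 3 m" if "fits m s T" for m s T
  proof -
    have "length (orc (length (s r))) \<le> 4 ^ length (s r)" by (rule orc)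
    also have "\<dots> \<le> 4 ^ m" using that assms(1) by (auto simp: fits_def intro: power_increasing)
    also have "\<dots> \<le> growth 3 m" by (rule power_le_growth)
    finally show ?thesis .
  qed
  moreover have "length (s i) \<le> growth 3 m" if "fits m s T" "i \<noteq> 1" for m s T i
    using that growth_ge le_trans unfolding fits_def by blast
  moreover have "Suc T \<le> growth 3 m" if "fits m s T" for m s T
    using that growth_gt[of m 3] unfolding fits_def by linarith
  ultimately have "fits (growth 3 m) (s(r := orc (length (s r)))) (T + 1)" if "fits m s T" for m s T
    using that by (auto simp: fits_def)
  then have "realizes_at orc 3 (Query r) (\<lambda>s s'. s' = s(r := orc (length (s r))))"
    unfolding realizes_at_def using exec_Query by blast
  then show ?thesis unfolding realizes_def by blast
qed

text \<open>The body strictly shortens \<open>r\<close>, so there are at most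
  \<open>length (s r)\<close> rounds, and this is at most \<open>m\<close> because \<open>r\<close>
  is a bounded register. Each round applies level \<open>Suc j\<close>, and iterating that is what
  the next level does. The invariant \<open>J\<close> relates the initial state to the current
  one.\<close>

lemma realizes_Loop:
  assumes "realizes orc c R" and r: "r \<noteq> 1"
    and dec: "\<And>s s'. R s s' \<Longrightarrow> s r \<noteq> [] \<Longrightarrow> length (s' r) < length (s r)"
    and init: "\<And>s. J s s"
    and step: "\<And>s0 s s'. J s0 s \<Longrightarrow> s r \<noteq> [] \<Longrightarrow> R s s' \<Longrightarrow> J s0 s'"
  shows "realizes orc (Loop r c) (\<lambda>s s'. J s s' \<and> s' r = [])"
proof -
  from assms(1) obtain j where j: "realizes_at orc j c R"
    unfolding realizes_def by blast
  have "realizes_at orc (Suc (Suc j)) (Loop r c) (\<lambda>s s'. J s s' \<and> s' r = [])"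
    unfolding realizes_at_def
  proof
    fix s0
    \<comment> \<open>The outer \<open>Suc\<close> accounts for the final test, which finds
      \<open>r\<close> empty.\<close>
    have "\<exists>k s'. exec orc (Loop r c) s k s' \<and> (J s0 s' \<and> s' r = []) \<and>
        (\<forall>m T. fits m s T \<longrightarrow> fits (Suc ((growth (Suc j) ^^ length (s r)) m)) s' (T + k))"
      if "J s0 s" for s
      using that
    proof (induction "length (s r)" arbitrary: s rule: less_induct)
      case less
      show ?case
      proof (cases "s r = []")
        case True
        then show ?thesis using exec_LoopF[where orc = orc] less.prems fits_Suc
          by (metis Suc_eq_plus1 funpow_0 list.size(3))
      next
        case False
        from realizes_atE[OF j, of s] obtain k1 s1 where 1: "exec orc c s k1 s1" "R s s1"
          "\<And>m T. fits m s T \<Longrightarrow> fits (growth j m) s1 (T + k1)" by blast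
        have lt: "length (s1 r) < length (s r)" using dec 1(2) False by blast
        moreover have "J s0 s1" using step less.prems False 1(2) by blast
        ultimately obtain k2 s2 where 2: "exec orc (Loop r c) s1 k2 s2" "J s0 s2 \<and> s2 r = []"
          "\<And>m T. fits m s1 T \<Longrightarrow>
             fits (Suc ((growth (Suc j) ^^ length (s1 r)) m)) s2 (T + k2)"
          using less.hyps by blast
        have "fits (Suc ((growth (Suc j) ^^ length (s r)) m)) s2 (T + Suc (k1 + k2))"
          if "fits m s T" for m T
        proof -
          \<comment> \<open>The step spent on the test is charged by starting the clock of the body
            at \<open>Suc T\<close>.\<close>
          have "fits (growth (Suc j) m) s1 (Suc T + k1)"
            using fits_mono[OF 1(3)[OF fits_Suc[OF that]] growth_Suc_arg_le] .
          from 2(3)[OF this]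
          have "fits (Suc ((growth (Suc j) ^^ Suc (length (s1 r))) m)) s2 (Suc T + k1 + k2)"
            by (simp add: funpow_swap1)
          moreover have "(growth (Suc j) ^^ Suc (length (s1 r))) m \<le> (growth (Suc j) ^^ length (s r)) m"
            using lt by (intro funpow_increasing growth_ge) simp
          ultimately show ?thesis using fits_mono by (simp add: add.assoc)
        qed
        then show ?thesis using exec_LoopT[OF False 1(1) 2(1)] 2(2) by blast
      qed
    qed
    from this[OF init] obtain k s' where 1: "exec orc (Loop r c) s0 k s'" "J s0 s' \<and> s' r = []"
      "\<And>m T. fits m s0 T \<Longrightarrow> fits (Suc ((growth (Suc j) ^^ length (s0 r)) m)) s' (T + k)"
      by blast
    have "fits (growth (Suc (Suc j)) m) s' (T + k)" if "fits m s0 T" for m T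
    proof -
      have "Suc ((growth (Suc j) ^^ length (s0 r)) m) \<le> (growth (Suc j) ^^ Suc (length (s0 r))) m"
        using growth_gt by (simp add: Suc_leI)
      also have "\<dots> \<le> (growth (Suc j) ^^ (m + 2)) m"
        using that r by (intro funpow_increasing growth_ge) (auto simp: fits_def)
      finally show ?thesis using fits_mono[OF 1(3)[OF that]] by (simp add: growth.simps(2) del: funpow.simps)
    qed
    then show "\<exists>k s'. exec orc (Loop r c) s0 k s' \<and> (J s0 s' \<and> s' r = []) \<and>
        (\<forall>m T. fits m s0 T \<longrightarrow> fits (growth (Suc (Suc j)) m) s' (T + k))"
      using 1 by blast
  qed
  then show ?thesis unfolding realizes_def by blast
qed

section \<open>Unary register operations\<close>

primrec pushes :: "nat list \<Rightarrow> instr" where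
  "pushes [] = Skip"
| "pushes (t # ts) = Then (Push t True) (pushes ts)"

lemma oracle_free_pushes [simp]: "oracle_free (pushes ts)"
  by (induction ts) auto

lemma realizes_pushes:
  "realizes orc (pushes ts) (\<lambda>s s'. s' = (\<lambda>i. replicate (count_list ts i) True @ s i))"
proof (induction ts)
  case Nil
  then show ?case using realizes_Skip by simp
next
  case (Cons t ts)
  show ?case
    unfolding pushes.simps
    by (rule realizes_weaken[OF realizes_Then[OF realizes_Push Cons.IH]])
      (auto simp: fun_eq_iff replicate_app_Cons_same)
qed

definition clear :: "nat \<Rightarrow> instr" where
  "clear r = Loop r (Pop r)"

text \<open>Unary addition into several registers at once: two distinct targets give a copy with a
  backup, a repeated target doubles.\<close>

definition drain :: "nat \<Rightarrow> nat list \<Rightarrow> instr" where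
  "drain r ts = Loop r (Then (Pop r) (pushes ts))"

lemma oracle_free_clear [simp]: "oracle_free (clear r)"
  by (simp add: clear_def)

lemma oracle_free_drain [simp]: "oracle_free (drain r ts)"
  by (simp add: drain_def)

lemma realizes_clear:
  assumes "r \<noteq> 1"
  shows "realizes orc (clear r) (\<lambda>s s'. s' = s(r := []))"
proof -
  have "realizes orc (clear r) (\<lambda>s s'. (\<exists>u. s' = s(r := u)) \<and> s' r = [])"
    unfolding clear_def
    using assms by (intro realizes_Loop[OF realizes_Pop]) (auto intro: fun_upd_triv[symmetric])
  then show ?thesis by (rule realizes_weaken) auto
qed

lemma realizes_drain:
  assumes "r \<noteq> 1" "r \<notin> set ts"
  shows "realizes orc (drain r ts) (\<lambda>s s'. s' =
    (\<lambda>i. if i = r then [] else replicate (count_list ts i * length (s r)) True @ s i))"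
proof -
  have r0: "count_list ts r = 0" using assms(2) by (simp add: count_list_0_iff)
  \<comment> \<open>The witness \<open>l\<close> is the number of rounds completed.\<close>
  have "realizes orc (drain r ts) (\<lambda>s s'. (\<exists>l. l + length (s' r) = length (s r) \<and>
      (\<forall>i. i \<noteq> r \<longrightarrow> s' i = replicate (count_list ts i * l) True @ s i)) \<and> s' r = [])"
    unfolding drain_def
  proof (rule realizes_Loop[OF realizes_Then[OF realizes_Pop realizes_pushes] assms(1)])
    fix s0 s s' :: state
    assume "\<exists>l. l + length (s r) = length (s0 r) \<and>
      (\<forall>i. i \<noteq> r \<longrightarrow> s i = replicate (count_list ts i * l) True @ s0 i)"
    then obtain l where l: "l + length (s r) = length (s0 r)"
      "\<And>i. i \<noteq> r \<Longrightarrow> s i = replicate (count_list ts i * l) True @ s0 i" by blast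
    assume "s r \<noteq> []" and step: "((\<lambda>s s'. s' = s(r := tl (s r))) OO
      (\<lambda>s s'. s' = (\<lambda>i. replicate (count_list ts i) True @ s i))) s s'"
    then show "\<exists>l. l + length (s' r) = length (s0 r) \<and>
      (\<forall>i. i \<noteq> r \<longrightarrow> s' i = replicate (count_list ts i * l) True @ s0 i)"
      using l r0 by (intro exI[of _ "Suc l"])
        (auto simp: replicate_add algebra_simps Suc_le_eq simp flip: length_greater_0_conv)
  qed (auto simp: r0)
  then show ?thesis by (rule realizes_weaken) (auto simp: fun_eq_iff)
qed

section \<open>Primitive recursion on unary registers\<close>

text \<open>The index runs downwards and the value is accumulated, so that \<open>Loop\<close> can
  execute it directly: the length of the counter after a pop is the index handed to
  \<open>g\<close>.\<close>

primrec itr :: "(nat \<Rightarrow> nat \<Rightarrow> nat) \<Rightarrow> nat \<Rightarrow> nat \<Rightarrow> nat" where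
  "itr g 0 a = a"
| "itr g (Suc n) a = itr g n (g n a)"

text \<open>Numbers are represented by the lengths of registers, the contents being irrelevant.  The value
  is left in register \<open>h\<close>; everything above \<open>h\<close> is scratch space.\<close>

definition pr :: "(nat \<Rightarrow> bool list) \<Rightarrow> ((nat \<Rightarrow> nat) \<Rightarrow> nat) \<Rightarrow> bool" where
  "pr orc e \<longleftrightarrow> (\<forall>\<rho> h. 2 \<le> h \<and> (\<forall>i. \<rho> i < h \<and> \<rho> i \<noteq> 1) \<longrightarrow>
     (\<exists>c. oracle_free c \<and> realizes orc c (\<lambda>s s'.
        length (s' h) = e (\<lambda>i. length (s (\<rho> i))) \<and> (\<forall>i<h. length (s' i) = length (s i)))))"

lemma prE:
  assumes "pr orc e" "2 \<le> h" "\<And>i. \<rho> i < h" "\<And>i. \<rho> i \<noteq> 1"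
  obtains c where "oracle_free c" "realizes orc c (\<lambda>s s'.
        length (s' h) = e (\<lambda>i. length (s (\<rho> i))) \<and> (\<forall>i<h. length (s' i) = length (s i)))"
  using assms unfolding pr_def by blast

lemma pr_var: "pr orc (\<lambda>env. env k)"
  unfolding pr_def
proof (intro allI impI exI conjI)
  fix \<rho> :: "nat \<Rightarrow> nat" and h
  assume h: "2 \<le> h \<and> (\<forall>i. \<rho> i < h \<and> \<rho> i \<noteq> 1)"
  \<comment> \<open>Draining destroys its source, so a second copy is made in \<open>Suc h\<close>
    and drained back. Only the length of the variable is restored, which is all that
    \<open>pr\<close> requires.\<close>
  let ?c = "Then (clear h) (Then (clear (Suc h)) (Then (drain (\<rho> k) [h, Suc h]) (drain (Suc h) [\<rho> k])))"
  show "oracle_free ?c" by simp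
  have ne: "h \<noteq> \<rho> k" "Suc h \<noteq> \<rho> k" "\<rho> k \<noteq> h" "\<rho> k \<noteq> Suc h" using h
    by (metis less_irrefl, metis less_Suc_eq less_irrefl, metis less_irrefl, metis less_Suc_eq less_irrefl)
  show "realizes orc ?c (\<lambda>s s'. length (s' h) = length (s (\<rho> k)) \<and>
      (\<forall>i<h. length (s' i) = length (s i)))"
    by (rule realizes_weaken[OF realizes_Then[OF realizes_clear realizes_Then[OF realizes_clear
        realizes_Then[OF realizes_drain realizes_drain]]]])
      (use h ne in auto)
qed

lemma pr_zero: "pr orc (\<lambda>env. 0)"
  unfolding pr_def
proof (intro allI impI exI conjI)
  fix \<rho> :: "nat \<Rightarrow> nat" and h
  assume h: "2 \<le> h \<and> (\<forall>i. \<rho> i < h \<and> \<rho> i \<noteq> 1)"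
  show "oracle_free (clear h)" by simp
  show "realizes orc (clear h) (\<lambda>s s'. length (s' h) = 0 \<and> (\<forall>i<h. length (s' i) = length (s i)))"
    by (rule realizes_weaken[OF realizes_clear]) (use h in auto)
qed

lemma pr_Suc:
  assumes "pr orc e"
  shows "pr orc (\<lambda>env. Suc (e env))"
  unfolding pr_def
proof (intro allI impI)
  fix \<rho> :: "nat \<Rightarrow> nat" and h
  assume h: "2 \<le> h \<and> (\<forall>i. \<rho> i < h \<and> \<rho> i \<noteq> 1)"
  from prE[OF assms, of h \<rho>] h obtain c where "oracle_free c" and c: "realizes orc c (\<lambda>s s'.
      length (s' h) = e (\<lambda>i. length (s (\<rho> i))) \<and> (\<forall>i<h. length (s' i) = length (s i)))"
    by blast
  then show "\<exists>c. oracle_free c \<and> realizes orc c (\<lambda>s s'.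
      length (s' h) = Suc (e (\<lambda>i. length (s (\<rho> i)))) \<and> (\<forall>i<h. length (s' i) = length (s i)))"
    by (intro exI[of _ "Then c (Push h True)"] conjI
        realizes_weaken[OF realizes_Then[OF c realizes_Push]]) auto
qed

lemma pr_minus_one:
  assumes "pr orc e"
  shows "pr orc (\<lambda>env. e env - 1)"
  unfolding pr_def
proof (intro allI impI)
  fix \<rho> :: "nat \<Rightarrow> nat" and h
  assume h: "2 \<le> h \<and> (\<forall>i. \<rho> i < h \<and> \<rho> i \<noteq> 1)"
  from prE[OF assms, of h \<rho>] h obtain c where "oracle_free c" and c: "realizes orc c (\<lambda>s s'.
      length (s' h) = e (\<lambda>i. length (s (\<rho> i))) \<and> (\<forall>i<h. length (s' i) = length (s i)))"
    by blast
  then show "\<exists>c. oracle_free c \<and> realizes orc c (\<lambda>s s'.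
      length (s' h) = e (\<lambda>i. length (s (\<rho> i))) - 1 \<and> (\<forall>i<h. length (s' i) = length (s i)))"
    by (intro exI[of _ "Then c (Pop h)"] conjI
        realizes_weaken[OF realizes_Then[OF c realizes_Pop]]) auto
qed

lemma pr_rename:
  assumes "pr orc e"
  shows "pr orc (\<lambda>env. e (\<lambda>i. env (\<sigma> i)))"
  unfolding pr_def
proof (intro allI impI)
  fix \<rho> :: "nat \<Rightarrow> nat" and h
  assume h: "2 \<le> h \<and> (\<forall>i. \<rho> i < h \<and> \<rho> i \<noteq> 1)"
  show "\<exists>c. oracle_free c \<and> realizes orc c (\<lambda>s s'.
      length (s' h) = e (\<lambda>i. length (s (\<rho> (\<sigma> i)))) \<and> (\<forall>i<h. length (s' i) = length (s i)))"
    by (rule prE[OF assms, of h "\<lambda>i. \<rho> (\<sigma> i)"]) (use h in auto)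
qed

text \<open>Variables are de Bruijn indices: in \<open>g\<close>, index 0 is the counter, 1 the
  accumulator, and the outer variables follow. They are placed in registers \<open>h\<close> and
  \<open>Suc h\<close> and in their old registers; the value of \<open>g\<close> is computed in
  \<open>h + 2\<close> and then replaces the accumulator.\<close>

lemma pr_itr:
  assumes g: "pr orc (\<lambda>env. g (env 0) (env 1) (\<lambda>i. env (i + 2)))"
    and n: "pr orc n" and a: "pr orc a"
  shows "pr orc (\<lambda>env. itr (\<lambda>i acc. g i acc env) (n env) (a env))"
  unfolding pr_def
proof (intro allI impI)
  fix \<rho> :: "nat \<Rightarrow> nat" and h
  assume h: "2 \<le> h \<and> (\<forall>i. \<rho> i < h \<and> \<rho> i \<noteq> 1)"
  have \<rho>: "\<rho> i < h" "\<rho> i < Suc h" "\<rho> i \<noteq> h" for i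
    using h less_SucI less_irrefl by metis+
  let ?\<rho> = "\<lambda>i. if i = 0 then h else if i = 1 then Suc h else \<rho> (i - 2)"
  obtain cn where cn: "oracle_free cn" "realizes orc cn (\<lambda>s s'.
      length (s' h) = n (\<lambda>i. length (s (\<rho> i))) \<and> (\<forall>i<h. length (s' i) = length (s i)))"
    by (rule prE[OF n, of h \<rho>]) (use h in auto)
  obtain ca where ca: "oracle_free ca" "realizes orc ca (\<lambda>s s'.
      length (s' (Suc h)) = a (\<lambda>i. length (s (\<rho> i))) \<and>
      (\<forall>i<Suc h. length (s' i) = length (s i)))"
    by (rule prE[OF a, of "Suc h" \<rho>]) (use h in \<open>auto simp: less_SucI\<close>)
  obtain cg where cg: "oracle_free cg" "realizes orc cg (\<lambda>s s'.
      length (s' (h + 2)) = g (length (s h)) (length (s (Suc h))) (\<lambda>i. length (s (\<rho> i))) \<and>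
      (\<forall>i<h + 2. length (s' i) = length (s i)))"
    by (rule prE[OF g, of "h + 2" ?\<rho>]) (use h in \<open>auto simp: less_SucI\<close>)
  define body where "body = Then (Pop h) (Then cg (Then (clear (Suc h)) (drain (h + 2) [Suc h])))"
  have body: "realizes orc body (\<lambda>s s'. length (s' h) = length (s h) - 1 \<and>
      length (s' (Suc h)) =
        g (length (s h) - 1) (length (s (Suc h))) (\<lambda>i. length (s (\<rho> i))) \<and>
      (\<forall>i<h. length (s' i) = length (s i)))"
    unfolding body_def
    by (rule realizes_weaken[OF realizes_Then[OF realizes_Pop realizes_Then[OF cg(2)
        realizes_Then[OF realizes_clear realizes_drain]]]])
      (use h in \<open>auto simp: \<rho>\<close>)
  \<comment> \<open>Invariant: iterating from the current counter and accumulator still gives the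
    final value.\<close>
  have loop: "realizes orc (Loop h body) (\<lambda>s s'. ((\<forall>i<h. length (s' i) = length (s i)) \<and>
      itr (\<lambda>i acc. g i acc (\<lambda>i. length (s (\<rho> i)))) (length (s' h)) (length (s' (Suc h))) =
      itr (\<lambda>i acc. g i acc (\<lambda>i. length (s (\<rho> i)))) (length (s h)) (length (s (Suc h)))) \<and>
      s' h = [])"
  proof (rule realizes_Loop[OF body])
    fix s0 s s' :: state
    assume J: "(\<forall>i<h. length (s i) = length (s0 i)) \<and>
      itr (\<lambda>i acc. g i acc (\<lambda>i. length (s0 (\<rho> i)))) (length (s h)) (length (s (Suc h))) =
      itr (\<lambda>i acc. g i acc (\<lambda>i. length (s0 (\<rho> i)))) (length (s0 h)) (length (s0 (Suc h)))"
      and "s h \<noteq> []" and R: "length (s' h) = length (s h) - 1 \<and>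
      length (s' (Suc h)) =
        g (length (s h) - 1) (length (s (Suc h))) (\<lambda>i. length (s (\<rho> i))) \<and>
      (\<forall>i<h. length (s' i) = length (s i))"
    obtain l where "length (s h) = Suc l" using \<open>s h \<noteq> []\<close> by (cases "s h") auto
    with J R h show "(\<forall>i<h. length (s' i) = length (s0 i)) \<and>
      itr (\<lambda>i acc. g i acc (\<lambda>i. length (s0 (\<rho> i)))) (length (s' h)) (length (s' (Suc h))) =
      itr (\<lambda>i acc. g i acc (\<lambda>i. length (s0 (\<rho> i)))) (length (s0 h)) (length (s0 (Suc h)))"
      by auto
  qed (use h in auto)
  let ?c = "Then cn (Then ca (Then (Loop h body) (drain (Suc h) [h])))"
  have "oracle_free ?c" using cn ca cg by (simp add: body_def)
  moreover have "realizes orc ?c (\<lambda>s s'. length (s' h) =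
      itr (\<lambda>i acc. g i acc (\<lambda>i. length (s (\<rho> i)))) (n (\<lambda>i. length (s (\<rho> i)))) (a (\<lambda>i. length (s (\<rho> i))))
      \<and> (\<forall>i<h. length (s' i) = length (s i)))"
    by (rule realizes_weaken[OF realizes_Then[OF cn(2) realizes_Then[OF ca(2)
        realizes_Then[OF loop realizes_drain]]]])
      (use h in \<open>auto simp: \<rho>\<close>)
  ultimately show "\<exists>c. oracle_free c \<and> realizes orc c (\<lambda>s s'. length (s' h) =
      itr (\<lambda>i acc. g i acc (\<lambda>i. length (s (\<rho> i)))) (n (\<lambda>i. length (s (\<rho> i)))) (a (\<lambda>i. length (s (\<rho> i))))
      \<and> (\<forall>i<h. length (s' i) = length (s i)))" by blast
qed

lemma pr_weaken: "pr orc e \<Longrightarrow> pr orc (\<lambda>env. e (\<lambda>i. env (i + k)))"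
  by (rule pr_rename)

lemma pr_const: "pr orc (\<lambda>env. k)"
  by (induction k) (auto intro: pr_zero pr_Suc)

lemma pr_add:
  assumes "pr orc a" "pr orc b"
  shows "pr orc (\<lambda>env. a env + b env)"
proof -
  have "itr (\<lambda>i acc. Suc acc) n m = m + n" for n m
    by (induction n arbitrary: m) auto
  then show ?thesis
    using pr_itr[where g = "\<lambda>i acc env. Suc acc", OF pr_Suc[OF pr_var] assms(2,1)] by simp
qed

lemma pr_diff:
  assumes "pr orc a" "pr orc b"
  shows "pr orc (\<lambda>env. a env - b env)"
proof -
  have "itr (\<lambda>i acc. acc - 1) n m = m - n" for n m
    by (induction n arbitrary: m) auto
  then show ?thesis
    using pr_itr[where g = "\<lambda>i acc env. acc - 1", OF pr_minus_one[OF pr_var] assms(2,1)] by simp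
qed

lemma pr_mult:
  assumes "pr orc a" "pr orc b"
  shows "pr orc (\<lambda>env. a env * b env)"
proof -
  have "itr (\<lambda>i acc. acc + k) n m = m + k * n" for n m k :: nat
    by (induction n arbitrary: m) auto
  then show ?thesis
    using pr_itr[where g = "\<lambda>i acc env. acc + a env",
        OF pr_add[OF pr_var pr_weaken[OF assms(1)]] assms(2) pr_zero] by simp
qed

lemma pr_power:
  assumes "pr orc a" "pr orc b"
  shows "pr orc (\<lambda>env. a env ^ b env)"
proof -
  have "itr (\<lambda>i acc. acc * k) n m = m * k ^ n" for n m k :: nat
    by (induction n arbitrary: m) auto
  then show ?thesis
    using pr_itr[where g = "\<lambda>i acc env. acc * a env",
        OF pr_mult[OF pr_var pr_weaken[OF assms(1)]] assms(2) pr_const[where k = 1]] by simp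
qed

lemma pr_growth: "pr orc e \<Longrightarrow> pr orc (\<lambda>env. growth j (e env))"
proof (induction j arbitrary: e)
  case 0
  then show ?case by (simp add: pr_Suc)
next
  case (Suc j)
  have "itr (\<lambda>i. g) n m = (g ^^ n) m" for g n m
    by (induction n arbitrary: m) (simp_all add: funpow_swap1)
  then show ?case
    using pr_itr[where g = "\<lambda>i acc env. growth j acc",
        OF Suc.IH[OF pr_var] pr_Suc[OF pr_Suc[OF Suc.prems]] Suc.prems]
    by (simp add: growth.simps(2) del: funpow.simps)
qed

section \<open>Primitive recursive relations and bounded search\<close>

definition pr_rel :: "(nat \<Rightarrow> bool list) \<Rightarrow> ((nat \<Rightarrow> nat) \<Rightarrow> bool) \<Rightarrow> bool" where
  "pr_rel orc P \<longleftrightarrow> pr orc (\<lambda>env. of_bool (P env))"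

lemma pr_rel_not:
  assumes "pr_rel orc P"
  shows "pr_rel orc (\<lambda>env. \<not> P env)"
proof -
  have "of_bool (\<not> b) = 1 - (of_bool b :: nat)" for b by simp
  then show ?thesis
    using assms unfolding pr_rel_def by (simp only: pr_diff pr_const)
qed

lemma pr_rel_and:
  "pr_rel orc P \<Longrightarrow> pr_rel orc Q \<Longrightarrow> pr_rel orc (\<lambda>env. P env \<and> Q env)"
  unfolding pr_rel_def of_bool_conj by (rule pr_mult)

lemma pr_rel_imp:
  assumes "pr_rel orc P" "pr_rel orc Q"
  shows "pr_rel orc (\<lambda>env. P env \<longrightarrow> Q env)"
  using pr_rel_not[OF pr_rel_and[OF assms(1) pr_rel_not[OF assms(2)]]] by simp

lemma pr_rel_pos:
  assumes "pr orc e"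
  shows "pr_rel orc (\<lambda>env. 0 < e env)"
proof -
  have "of_bool (0 < n) = 1 - (1 - n)" for n :: nat
    by (cases n) auto
  then show ?thesis
    unfolding pr_rel_def using assms by (simp only: pr_diff pr_const)
qed

lemma pr_rel_less:
  assumes "pr orc a" "pr orc b"
  shows "pr_rel orc (\<lambda>env. a env < b env)"
  using pr_rel_pos[OF pr_diff[OF assms(2,1)]] by simp

lemma pr_rel_le:
  assumes "pr orc a" "pr orc b"
  shows "pr_rel orc (\<lambda>env. a env \<le> b env)"
  using pr_rel_less[OF assms(1) pr_Suc[OF assms(2)]] by (simp add: less_Suc_eq_le)

lemma pr_rel_eq:
  assumes "pr orc a" "pr orc b"
  shows "pr_rel orc (\<lambda>env. a env = b env)"
  unfolding eq_iff using assms by (intro pr_rel_and pr_rel_le)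

text \<open>The iteration counts the witnesses below the bound; one exists iff the count is
  positive.\<close>

lemma pr_rel_ex:
  assumes P: "pr_rel orc (\<lambda>env. P (env 0) (\<lambda>i. env (i + 1)))" and n: "pr orc n"
  shows "pr_rel orc (\<lambda>env. \<exists>i<n env. P i env)"
proof -
  have "0 < itr (\<lambda>i acc. acc + of_bool (Q i)) n m \<longleftrightarrow> 0 < m \<or> (\<exists>i<n. Q i)" for Q n m
    by (induction n arbitrary: m) (auto simp: less_Suc_eq)
  then have "(\<lambda>env. 0 < itr (\<lambda>i acc. acc + of_bool (P i env)) (n env) 0) =
      (\<lambda>env. \<exists>i<n env. P i env)"
    by simp
  \<comment> \<open>In the body of the iteration index 1 is the accumulator, so the renaming makes
    \<open>P\<close> skip it.\<close>
  moreover have "pr orc (\<lambda>env. env 1 + of_bool (P (env 0) (\<lambda>i. env (i + 2))))"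
    using pr_rename[OF P[unfolded pr_rel_def], of "\<lambda>i. if i = 0 then 0 else Suc i"]
    by (intro pr_add pr_var) simp
  ultimately show ?thesis
    using pr_rel_pos[OF pr_itr[where g = "\<lambda>i acc env. acc + of_bool (P i env)", OF _ n pr_zero]]
    by simp
qed

lemma pr_rel_all:
  assumes P: "pr_rel orc (\<lambda>env. P (env 0) (\<lambda>i. env (i + 1)))" and n: "pr orc n"
  shows "pr_rel orc (\<lambda>env. \<forall>i<n env. P i env)"
  using pr_rel_not[OF pr_rel_ex[OF pr_rel_not[OF P] n]] by simp

text \<open>Reduces bit tests to bounded quantifiers over arithmetic, for which closure is already
  established: \<open>2 * a + 1\<close> is the odd quotient by \<open>2 ^ q\<close> and
  \<open>b\<close> the remainder.\<close>

lemma bit_nat_iff_ex: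
  fixes F q :: nat
  shows "bit F q \<longleftrightarrow> (\<exists>a<Suc F. \<exists>b<2 ^ q. F = (2 * a + 1) * 2 ^ q + b)"
proof
  assume "bit F q"
  then obtain a where a: "F div 2 ^ q = 2 * a + 1"
    unfolding bit_iff_odd by (elim oddE)
  then have "F = (2 * a + 1) * 2 ^ q + F mod 2 ^ q"
    using div_mult_mod_eq[of F "2 ^ q"] by simp
  moreover have "2 * a + 1 \<le> F" using a div_le_dividend[of F "2 ^ q"] by simp
  then have "a < Suc F" by simp
  ultimately show "\<exists>a<Suc F. \<exists>b<2 ^ q. F = (2 * a + 1) * 2 ^ q + b"
    by (metis mod_less_divisor zero_less_numeral zero_less_power)
next
  assume "\<exists>a<Suc F. \<exists>b<2 ^ q. F = (2 * a + 1) * 2 ^ q + b"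
  then obtain a b where "b < 2 ^ q" "F = (2 * a + 1) * 2 ^ q + b" by blast
  then have "F div 2 ^ q = 2 * a + 1" using div_mult_self3[of "2 ^ q" "2 * a + 1" b] by simp
  then show "bit F q" by (simp add: bit_iff_odd)
qed

lemma pr_rel_bit:
  assumes "pr orc F" "pr orc q"
  shows "pr_rel orc (\<lambda>env. bit (F env) (q env))"
proof -
  have F: "pr orc (\<lambda>env. F (\<lambda>i. env (i + 1 + 1)))"
    using pr_weaken[OF assms(1), of 2] by simp
  have q: "pr orc (\<lambda>env. q (\<lambda>i. env (i + 1)))" "pr orc (\<lambda>env. q (\<lambda>i. env (i + 1 + 1)))"
    using pr_weaken[OF assms(2), of 1] pr_weaken[OF assms(2), of 2] by simp_all
  show ?thesis
    unfolding bit_nat_iff_ex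
    by (intro pr_rel_ex pr_rel_eq pr_add pr_mult pr_power pr_const pr_var pr_Suc assms F q)
qed

text \<open>\<open>F\<close> codes a family of sets: the string with number \<open>j\<close> belongs to the set with index \<open>d\<close> iff bit
  \<open>d * 2\<^sup>n + j\<close> of \<open>F\<close> is set.  The indices run from \<open>2\<^sup>k\<close> to \<open>2\<^sup>k\<^sup>+\<^sup>1 - 1\<close>, so that an index determines \<open>k\<close>.\<close>

definition basis_code :: "nat \<Rightarrow> nat \<Rightarrow> nat \<Rightarrow> nat \<Rightarrow> bool" where
  "basis_code T n k F \<longleftrightarrow> (\<forall>i<2 ^ n. \<forall>j<2 ^ n. bit T (i * 2 ^ n + j) \<longrightarrow>
     (\<exists>d<2 ^ Suc k. 2 ^ k \<le> d \<and> bit F (d * 2 ^ n + j) \<and>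
        (\<forall>l<2 ^ n. bit F (d * 2 ^ n + l) \<longrightarrow> bit T (i * 2 ^ n + l))))"

text \<open>Taking the least code makes the family depend on \<open>T\<close>, \<open>n\<close> and
  \<open>k\<close> alone, so a program has only to name a member. The bounds on \<open>k\<close> and
  \<open>F\<close> keep the search primitive recursive.\<close>

definition selects :: "nat \<Rightarrow> nat \<Rightarrow> nat \<Rightarrow> nat \<Rightarrow> bool" where
  "selects T n v y \<longleftrightarrow> (\<exists>k<v. 2 ^ k \<le> v \<and> v < 2 ^ Suc k \<and>
     (\<exists>F<2 ^ (2 ^ Suc k * 2 ^ n). basis_code T n k F \<and>
        (\<forall>F'<F. \<not> basis_code T n k F') \<and> bit F (v * 2 ^ n + y)))"

lemmas pr_intros = pr_rel_ex pr_rel_all pr_rel_and pr_rel_not pr_rel_imp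
  pr_rel_less pr_rel_le pr_rel_bit pr_add pr_mult pr_power pr_const pr_var pr_Suc

lemma pr_selects: "pr_rel orc (\<lambda>env. selects (env 0) (env 1) (env 2) (env 3))"
  unfolding selects_def basis_code_def by (intro pr_intros)

lemma computable_growth: "computable (growth j)"
proof -
  obtain c where "oracle_free c" and "realizes (\<lambda>_. []) c (\<lambda>s s'.
      length (s' 4) = growth j (length (s 3)) \<and> (\<forall>i<4. length (s' i) = length (s i)))"
    by (rule prE[OF pr_growth[where j = j, OF pr_var[where k = 0]], where h = 4 and \<rho> = "\<lambda>_. 3"])
      auto
  then have c: "realizes (\<lambda>_. []) c (\<lambda>s s'.
      length (s' 4) = growth j (length (s 3)) \<and> length (s' 2) = length (s 2))"
    by (elim realizes_weaken) simp
  \<comment> \<open>The machine \<open>c\<close> controls only lengths; the last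
    \<open>drain\<close> rewrites the value with \<open>True\<close> entries, as the unary
    convention demands, into the still empty register 2.\<close>
  let ?c = "Then (drain 0 [3]) (Then c (drain 4 [2]))"
  have "realizes (\<lambda>_. []) ?c (\<lambda>s s'. \<forall>n. s = (\<lambda>_. [])(0 := replicate n True) \<longrightarrow>
      s' 2 = replicate (growth j n) True)"
    by (rule realizes_weaken[OF realizes_Then[OF realizes_drain realizes_Then[OF c realizes_drain]]])
      auto
  then have "\<exists>k s. exec (\<lambda>_. []) ?c ((\<lambda>_. [])(0 := replicate n True)) k s \<and>
      s 2 = replicate (growth j n) True" for n
    unfolding realizes_def realizes_at_def by blast
  with \<open>oracle_free c\<close> show ?thesis
    unfolding computable_def by (intro exI[of _ ?c]) simp
qed

section \<open>The machine\<close>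

text \<open>The least significant bit comes first, as in the order of the truth table.\<close>

abbreviation val :: "bool list \<Rightarrow> nat" where
  "val u \<equiv> horner_sum of_bool 2 u"

definition padded :: "nat \<Rightarrow> bool list \<Rightarrow> bool list" where
  "padded n u = map (\<lambda>i. i < length u \<and> u ! i) [0..<n]"

lemma starts_with_1_drop: "starts_with_1 (drop i u) \<longleftrightarrow> i < length u \<and> u ! i"
  by (auto simp: starts_with_1_def hd_drop_conv_nth)

definition copy_bit :: "nat \<Rightarrow> nat \<Rightarrow> instr" where
  "copy_bit r a = Cond r (Push a True) (Push a False)"

lemma realizes_copy_bit:
  "realizes orc (copy_bit r a) (\<lambda>s s'. s' = s(a := starts_with_1 (s r) # s a))"
  unfolding copy_bit_def
  by (rule realizes_weaken[OF realizes_Cond[OF realizes_Push realizes_Push]]) (auto split: if_splits)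

text \<open>Keeps the bits, whereas \<open>drain\<close> keeps only the length. The reversal brings
  the most significant bit to the top, where \<open>horner\<close> needs it.\<close>

definition transfer :: "nat \<Rightarrow> nat \<Rightarrow> instr" where
  "transfer r a = Loop r (Then (copy_bit r a) (Pop r))"

lemma realizes_transfer:
  assumes "r \<noteq> 1" "r \<noteq> a"
  shows "realizes orc (transfer r a) (\<lambda>s s'. s' = s(r := [], a := rev (s r) @ s a))"
proof -
  have "realizes orc (transfer r a) (\<lambda>s s'.
      (rev (s' r) @ s' a = rev (s r) @ s a \<and> (\<forall>i. i \<noteq> r \<and> i \<noteq> a \<longrightarrow> s' i = s i)) \<and> s' r = [])"
    unfolding transfer_def
  proof (rule realizes_Loop[OF realizes_Then[OF realizes_copy_bit realizes_Pop] assms(1)])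
    fix s0 s s' :: state
    assume "rev (s r) @ s a = rev (s0 r) @ s0 a \<and> (\<forall>i. i \<noteq> r \<and> i \<noteq> a \<longrightarrow> s i = s0 i)"
      and "s r \<noteq> []" and "((\<lambda>s s'. s' = s(a := starts_with_1 (s r) # s a)) OO
        (\<lambda>s s'. s' = s(r := tl (s r)))) s s'"
    then show "rev (s' r) @ s' a = rev (s0 r) @ s0 a \<and> (\<forall>i. i \<noteq> r \<and> i \<noteq> a \<longrightarrow> s' i = s0 i)"
      using assms(2) by (cases "s r") (auto simp: starts_with_1_def)
  qed (use assms(2) in auto)
  then show ?thesis by (rule realizes_weaken) (use assms(2) in \<open>auto simp: fun_eq_iff\<close>)
qed

text \<open>Turns a binary content into a unary length. The exponential blow-up is harmless, since
  the growth hierarchy absorbs it.\<close>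

definition horner :: "nat \<Rightarrow> nat \<Rightarrow> nat \<Rightarrow> instr" where
  "horner r a t = Loop r (Then (clear t) (Then (drain a [t, t]) (Then (Cond r (Push t True) Skip)
     (Then (Pop r) (drain t [a])))))"

lemma realizes_horner:
  assumes "r \<noteq> 1" "a \<noteq> 1" "t \<noteq> 1" "r \<noteq> a" "r \<noteq> t" "a \<noteq> t"
  shows "realizes orc (horner r a t) (\<lambda>s s'.
    length (s' a) = foldl (\<lambda>n b. 2 * n + of_bool b) (length (s a)) (s r) \<and>
    (\<forall>i. i \<noteq> r \<and> i \<noteq> a \<and> i \<noteq> t \<longrightarrow> s' i = s i))"
proof -
  have body: "realizes orc (Then (clear t) (Then (drain a [t, t])
     (Then (Cond r (Push t True) Skip) (Then (Pop r) (drain t [a])))))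
    (\<lambda>s s'. length (s' a) = 2 * length (s a) + of_bool (starts_with_1 (s r)) \<and>
      s' r = tl (s r) \<and> (\<forall>i. i \<noteq> r \<and> i \<noteq> a \<and> i \<noteq> t \<longrightarrow> s' i = s i))"
  proof (rule realizes_weaken[OF realizes_Then[OF realizes_clear realizes_Then[OF realizes_drain
        realizes_Then[OF realizes_Cond[OF realizes_Push realizes_Skip]
        realizes_Then[OF realizes_Pop realizes_drain]]]]])
    fix s s' :: state
    assume "((\<lambda>s s'. s' = s(t := [])) OO
      (\<lambda>s s'. s' = (\<lambda>i. if i = a then []
        else replicate (count_list [t, t] i * length (s a)) True @ s i)) OO
      (\<lambda>s s'. if starts_with_1 (s r) then s' = s(t := True # s t) else s' = s) OO
      (\<lambda>s s'. s' = s(r := tl (s r))) OO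
      (\<lambda>s s'. s' = (\<lambda>i. if i = t then []
        else replicate (count_list [a] i * length (s t)) True @ s i))) s s'"
    then obtain s1 s2 s3 s4 where *: "s1 = s(t := [])"
      "s2 = (\<lambda>i. if i = a then [] else replicate (count_list [t, t] i * length (s1 a)) True @ s1 i)"
      "if starts_with_1 (s2 r) then s3 = s2(t := True # s2 t) else s3 = s2"
      "s4 = s3(r := tl (s3 r))"
      "s' = (\<lambda>i. if i = t then [] else replicate (count_list [a] i * length (s4 t)) True @ s4 i)"
      by (elim relcomppE) blast
    have s2: "s2 t = replicate (2 * length (s a)) True" "s2 a = []"
      "\<And>i. i \<noteq> a \<Longrightarrow> i \<noteq> t \<Longrightarrow> s2 i = s i"
      using assms(6) by (simp_all add: *(1,2))
    have s3: "length (s3 t) = 2 * length (s a) + of_bool (starts_with_1 (s r))" "s3 a = []"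
      "\<And>i. i \<noteq> a \<Longrightarrow> i \<noteq> t \<Longrightarrow> s3 i = s i"
      using assms(4-6) *(3) s2 by (auto split: if_splits)
    show "length (s' a) = 2 * length (s a) + of_bool (starts_with_1 (s r)) \<and>
      s' r = tl (s r) \<and> (\<forall>i. i \<noteq> r \<and> i \<noteq> a \<and> i \<noteq> t \<longrightarrow> s' i = s i)"
      using assms(4-6) s3 by (simp add: *(4,5))
  qed (use assms in auto)
  have "realizes orc (horner r a t) (\<lambda>s s'.
      (foldl (\<lambda>n b. 2 * n + of_bool b) (length (s' a)) (s' r) =
        foldl (\<lambda>n b. 2 * n + of_bool b) (length (s a)) (s r) \<and>
      (\<forall>i. i \<noteq> r \<and> i \<noteq> a \<and> i \<noteq> t \<longrightarrow> s' i = s i)) \<and> s' r = [])"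
    unfolding horner_def
  proof (rule realizes_Loop[OF body assms(1)])
    fix s0 s s' :: state
    assume J: "foldl (\<lambda>n b. 2 * n + of_bool b) (length (s a)) (s r) =
        foldl (\<lambda>n b. 2 * n + of_bool b) (length (s0 a)) (s0 r) \<and>
      (\<forall>i. i \<noteq> r \<and> i \<noteq> a \<and> i \<noteq> t \<longrightarrow> s i = s0 i)"
      and "s r \<noteq> []" and R: "length (s' a) = 2 * length (s a) + of_bool (starts_with_1 (s r)) \<and>
      s' r = tl (s r) \<and> (\<forall>i. i \<noteq> r \<and> i \<noteq> a \<and> i \<noteq> t \<longrightarrow> s' i = s i)"
    obtain b u where "s r = b # u" using \<open>s r \<noteq> []\<close> by (cases "s r") auto
    with J R show "foldl (\<lambda>n b. 2 * n + of_bool b) (length (s' a)) (s' r) =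
        foldl (\<lambda>n b. 2 * n + of_bool b) (length (s0 a)) (s0 r) \<and>
      (\<forall>i. i \<noteq> r \<and> i \<noteq> a \<and> i \<noteq> t \<longrightarrow> s' i = s0 i)"
      by (simp add: starts_with_1_def)
  qed auto
  then show ?thesis by (rule realizes_weaken) auto
qed

lemma foldl_rev_eq_val: "foldl (\<lambda>n b. 2 * n + of_bool b) 0 (rev u) = val u"
  by (induction u) auto

text \<open>Only \<open>length y\<close> bits of the data are read, padded with zeros if there are fewer; so the time does
  not depend on the length of the data.\<close>

definition read_input :: instr where
  "read_input = Loop 0 (Then (copy_bit 0 3) (Then (copy_bit 1 4) (Then (Pop 1)
     (Then (Push 5 True) (Then (Push 6 True) (Pop 0))))))"

lemma realizes_read_input:
  "realizes orc read_input (\<lambda>s s'. s' = s(0 := [], 1 := drop (length (s 0)) (s 1),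
     3 := rev (s 0) @ s 3, 4 := rev (padded (length (s 0)) (s 1)) @ s 4,
     5 := replicate (length (s 0)) True @ s 5, 6 := replicate (length (s 0)) True @ s 6))"
proof -
  \<comment> \<open>The state after \<open>i\<close> rounds. The input length is recorded twice
    because the query will overwrite register 6.\<close>
  define upto :: "nat \<Rightarrow> state \<Rightarrow> state" where
    "upto i s = s(0 := drop i (s 0), 1 := drop i (s 1),
       3 := rev (take i (s 0)) @ s 3, 4 := rev (padded i (s 1)) @ s 4,
       5 := replicate i True @ s 5, 6 := replicate i True @ s 6)" for i s
  have "realizes orc read_input
      (\<lambda>s s'. (\<exists>i\<le>length (s 0). s' = upto i s) \<and> s' 0 = [])"
    unfolding read_input_def
  proof (rule realizes_Loop[OF realizes_Then[OF realizes_copy_bit realizes_Then[OF realizes_copy_bit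
        realizes_Then[OF realizes_Pop realizes_Then[OF realizes_Push
        realizes_Then[OF realizes_Push realizes_Pop]]]]]])
    fix s0 s s' :: state
    assume "\<exists>i\<le>length (s0 0). s = upto i s0"
    then obtain i where i: "i \<le> length (s0 0)" "s = upto i s0" by blast
    assume "s 0 \<noteq> []"
    with i have lt: "i < length (s0 0)" by (simp add: upto_def)
    assume "((\<lambda>s s'. s' = s(3 := starts_with_1 (s 0) # s 3)) OO
      (\<lambda>s s'. s' = s(4 := starts_with_1 (s 1) # s 4)) OO
      (\<lambda>s s'. s' = s(1 := tl (s 1))) OO (\<lambda>s s'. s' = s(5 := True # s 5)) OO
      (\<lambda>s s'. s' = s(6 := True # s 6)) OO (\<lambda>s s'. s' = s(0 := tl (s 0)))) s s'"
    then have "s' = s(0 := tl (s 0), 1 := tl (s 1), 3 := starts_with_1 (s 0) # s 3,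
        4 := starts_with_1 (s 1) # s 4, 5 := True # s 5, 6 := True # s 6)"
      by (auto simp: fun_eq_iff)
    also have "\<dots> = upto (Suc i) s0"
      using lt by (auto simp: fun_eq_iff i(2) upto_def starts_with_1_drop padded_def
          take_Suc_conv_app_nth drop_Suc tl_drop)
    finally show "\<exists>i\<le>length (s0 0). s' = upto i s0" using lt by (intro exI[of _ "Suc i"]) simp
  next
    show "\<exists>i\<le>length (s 0). s = upto i s" for s
      by (intro exI[of _ 0]) (auto simp: upto_def padded_def fun_eq_iff)
  qed auto
  then show ?thesis
    by (rule realizes_weaken) (auto simp: upto_def)
qed

lemma realizes_selects:
  assumes "\<And>n. length (orc n) \<le> 4 ^ n"
  obtains c where "realizes orc c (\<lambda>s s'. \<forall>y d. s = (\<lambda>_. [])(0 := y, 1 := d) \<longrightarrow>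
    s' 2 = (if selects (val (orc (length y))) (length y) (val (padded (Suc (length y)) d)) (val y)
            then [True] else []))"
proof -
  define \<rho> :: "nat \<Rightarrow> nat" where
    "\<rho> i = (if i = 0 then 8 else if i = 1 then 5 else if i = 2 then 9 else 10)" for i
  obtain c where "realizes orc c (\<lambda>s s'.
      length (s' 12) = of_bool (selects (length (s 8)) (length (s 5)) (length (s 9)) (length (s 10))) \<and>
      (\<forall>i<12. length (s' i) = length (s i)))"
    by (rule prE[OF pr_selects[unfolded pr_rel_def], where h = 12 and \<rho> = \<rho>])
      (auto simp: \<rho>_def)
  then have c: "realizes orc c (\<lambda>s s'.
      length (s' 12) = of_bool (selects (length (s 8)) (length (s 5)) (length (s 9)) (length (s 10))) \<and>
      length (s' 2) = length (s 2))"
    by (elim realizes_weaken) simp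
  \<comment> \<open>The extra \<open>copy_bit 1 4\<close> reads bit number \<open>n + 1\<close> of
    the data: for \<open>k = n\<close> an index is a number of \<open>n + 1\<close> bits.\<close>
  have read: "realizes orc (Then read_input (Then (copy_bit 1 4) (Then (Query 6) (transfer 6 7))))
    (\<lambda>s s'. \<forall>y d. s = (\<lambda>_. [])(0 := y, 1 := d) \<longrightarrow> s' 2 = [] \<and> s' 3 = rev y \<and>
      s' 4 = rev (padded (Suc (length y)) d) \<and> length (s' 5) = length y \<and>
      s' 7 = rev (orc (length y)) \<and> s' 8 = [] \<and> s' 9 = [] \<and> s' 10 = [])"
    by (rule realizes_weaken[OF realizes_Then[OF realizes_read_input realizes_Then[OF
        realizes_copy_bit realizes_Then[OF realizes_Query realizes_transfer]]]])
      (use assms in \<open>auto simp: starts_with_1_drop padded_def\<close>)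
  have conv: "realizes orc (Then (horner 7 8 11) (Then (horner 4 9 11) (horner 3 10 11)))
    (\<lambda>s s'. s 8 = [] \<longrightarrow> s 9 = [] \<longrightarrow> s 10 = [] \<longrightarrow> length (s' 8) = val (rev (s 7)) \<and>
      length (s' 9) = val (rev (s 4)) \<and> length (s' 10) = val (rev (s 3)) \<and>
      s' 5 = s 5 \<and> s' 2 = s 2)"
    by (rule realizes_weaken[OF realizes_Then[OF realizes_horner realizes_Then[OF
        realizes_horner realizes_horner]]])
      (auto simp flip: foldl_rev_eq_val)
  \<comment> \<open>Draining a truth value into the empty register 2 leaves \<open>[True]\<close> or
    \<open>[]\<close>, that is, \<open>Yes\<close> or \<open>Dont_know\<close> and never
    \<open>No\<close>.\<close>
  show thesis
    by (rule that, rule realizes_weaken[OF realizes_Then[OF read realizes_Then[OF conv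
        realizes_Then[OF c realizes_drain[of 12 "[2]"]]]]]) auto
qed

section \<open>From families of sets to programs\<close>

lemma nth_concat_map_map:
  assumes "i < length xs" "j < length ys"
  shows "concat (map (\<lambda>x. map (g x) ys) xs) ! (i * length ys + j) = g (xs ! i) (ys ! j)"
  using assms
proof (induction xs arbitrary: i)
  case (Cons x xs)
  show ?case
  proof (cases i)
    case 0
    then show ?thesis using Cons.prems by (simp add: nth_append)
  next
    case (Suc i')
    have "concat (map (\<lambda>x. map (g x) ys) (x # xs)) ! (i * length ys + j) =
        concat (map (\<lambda>x. map (g x) ys) xs) ! (i' * length ys + j)"
      by (simp add: Suc nth_append)
    then show ?thesis using Cons Suc by simp
  qed
qed simp

lemma val_less: "val u < 2 ^ length u"
  by (induction u) auto

lemma val_replicate_False: "val (replicate m False) = 0"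
  by (induction m) auto

abbreviation all_lists :: "nat \<Rightarrow> bool list list" where
  "all_lists n \<equiv> List.n_lists n [False, True]"

lemma length_all_lists: "length (all_lists n) = 2 ^ n"
  by (simp add: length_n_lists numeral_2_eq_2)

text \<open>In \<open>List.n_lists\<close> the head varies fastest, so strings are enumerated by
  their value with the least significant bit first.\<close>

lemma nth_all_lists_val: "all_lists (length u) ! val u = u"
proof (induction u)
  case (Cons b u)
  have "all_lists (length (b # u)) ! (val u * length [False, True] + of_bool b) =
      ([False, True] ! of_bool b) # (all_lists (length u) ! val u)"
  proof -
    have "all_lists (length (b # u)) =
        concat (map (\<lambda>ys. map (\<lambda>y. y # ys) [False, True]) (all_lists (length u)))"
      by simp
    then show ?thesis
      using nth_concat_map_map[of "val u" "all_lists (length u)" "of_bool b" "[False, True]"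
          "\<lambda>ys y. y # ys"] val_less[of u] by (simp add: length_all_lists)
  qed
  then show ?case using Cons.IH by (simp add: algebra_simps numeral_2_eq_2)
qed simp

lemma ex_val_eq:
  assumes "i < 2 ^ n"
  shows "\<exists>u\<in>cube n. val u = i"
proof
  show "val (map (bit i) [0..<n]) = i"
    using assms by (simp add: horner_sum_bit_eq_take_bit take_bit_nat_eq_self)
qed (simp add: cube_def)

lemma length_truth_table: "length (truth_table f n) = 2 ^ n * 2 ^ n"
  by (simp add: truth_table_def length_concat comp_def length_all_lists sum_list_triv)

lemma bit_val: "bit (val u) q \<longleftrightarrow> q < length u \<and> u ! q"
  by (simp add: bit_horner_sum_bit_iff)

lemma pair_index_less:
  fixes a b i j :: nat
  assumes "i < a" "j < b"
  shows "i * b + j < a * b"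
proof -
  have "i * b + j < Suc i * b" using assms(2) by simp
  also have "\<dots> \<le> a * b" using assms(1) by (intro mult_le_mono1) simp
  finally show ?thesis .
qed

lemma bit_truth_table:
  assumes "x \<in> cube n" "y \<in> cube n"
  shows "bit (val (truth_table f n)) (val x * 2 ^ n + val y) \<longleftrightarrow> f n x y"
proof -
  have l: "length x = n" "length y = n" using assms by (auto simp: cube_def)
  then have less: "val x < 2 ^ n" "val y < 2 ^ n" using val_less[of x] val_less[of y] by simp_all
  have "truth_table f n ! (val x * length (all_lists n) + val y) =
      f n (all_lists n ! val x) (all_lists n ! val y)"
    unfolding truth_table_def by (rule nth_concat_map_map) (use less in \<open>auto simp: length_all_lists\<close>)
  moreover have "all_lists n ! val x = x" "all_lists n ! val y = y"
    using nth_all_lists_val[of x] nth_all_lists_val[of y] l by simp_all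
  ultimately show ?thesis
    using pair_index_less[OF less] by (simp add: bit_val length_truth_table length_all_lists)
qed

section \<open>Bases for the sets of columns\<close>

text \<open>A cover of the 1-entries by at most \<open>2 ^ k\<close> rectangles of 1-entries. Only
  the column sides \<open>B z\<close> are kept; as row side one can take all \<open>x\<close> with
  \<open>B z\<close> contained in \<open>Y1 f n x\<close>.\<close>

definition is_basis ::
  "(nat \<Rightarrow> bool list \<Rightarrow> bool list \<Rightarrow> bool) \<Rightarrow> nat \<Rightarrow> nat \<Rightarrow> (bool list \<Rightarrow> bool list set) \<Rightarrow> bool" where
  "is_basis f n k B \<longleftrightarrow>
     (\<forall>x\<in>cube n. \<forall>y\<in>Y1 f n x. \<exists>z\<in>cube k. y \<in> B z \<and> B z \<subseteq> Y1 f n x)"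

lemma is_basis_Y1: "is_basis f n n (Y1 f n)"
  unfolding is_basis_def by blast

lemma is_basis_code:
  assumes "is_basis f n k B"
  shows "\<exists>F<2 ^ (2 ^ Suc k * 2 ^ n). basis_code (val (truth_table f n)) n k F"
proof -
  let ?T = "val (truth_table f n)"
  \<comment> \<open>The block with index \<open>2 ^ k + val z\<close> lists the membership of
    \<open>B z\<close>. Blocks below \<open>2 ^ k\<close> get arbitrary content from truncated
    subtraction; \<open>basis_code\<close> asks only for indices from \<open>2 ^ k\<close>
    on.\<close>
  define u where "u = map (\<lambda>q. all_lists n ! (q mod 2 ^ n) \<in> B (all_lists k ! (q div 2 ^ n - 2 ^ k)))
    [0..<2 ^ Suc k * 2 ^ n]"
  have bit: "bit (val u) ((2 ^ k + val z) * 2 ^ n + val y) \<longleftrightarrow> y \<in> B z"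
    if "z \<in> cube k" "y \<in> cube n" for z y
  proof -
    have l: "length z = k" "length y = n" using that by (auto simp: cube_def)
    then have less: "val z < 2 ^ k" "val y < 2 ^ n" using val_less[of z] val_less[of y] by simp_all
    then have "(2 ^ k + val z) * 2 ^ n + val y < 2 ^ Suc k * 2 ^ n"
      by (intro pair_index_less) auto
    then show ?thesis
      using less nth_all_lists_val l by (auto simp: bit_val u_def)
  qed
  have "basis_code ?T n k (val u)"
    unfolding basis_code_def
  proof (intro allI impI)
    fix i j :: nat
    assume "i < 2 ^ n" "j < 2 ^ n" and T: "bit ?T (i * 2 ^ n + j)"
    then obtain x y where x: "x \<in> cube n" "val x = i" and y: "y \<in> cube n" "val y = j"
      using ex_val_eq by meson
    with T have "y \<in> Y1 f n x" using bit_truth_table by (auto simp: Y1_def)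
    with assms x(1) obtain z where z: "z \<in> cube k" "y \<in> B z" "B z \<subseteq> Y1 f n x"
      unfolding is_basis_def by blast
    have "bit ?T (i * 2 ^ n + l)" if l: "l < 2 ^ n" "bit (val u) ((2 ^ k + val z) * 2 ^ n + l)" for l
    proof -
      obtain y' where "y' \<in> cube n" "val y' = l" using ex_val_eq[OF l(1)] by blast
      with l(2) z x show ?thesis using bit bit_truth_table by (auto simp: Y1_def)
    qed
    moreover have "2 ^ k + val z < 2 ^ Suc k"
      using val_less[of z] z(1) by (simp add: cube_def)
    ultimately show "\<exists>d<2 ^ Suc k. 2 ^ k \<le> d \<and> bit (val u) (d * 2 ^ n + j) \<and>
        (\<forall>l<2 ^ n. bit (val u) (d * 2 ^ n + l) \<longrightarrow> bit ?T (i * 2 ^ n + l))"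
      using bit z y by (intro exI[of _ "2 ^ k + val z"]) auto
  qed
  then show ?thesis using val_less[of u] by (intro exI[of _ "val u"]) (simp add: u_def)
qed

text \<open>The family found by the search may differ from \<open>B\<close>. The given basis only
  shows that the search succeeds within its bound; the least code has the basis property by its
  choice.\<close>

lemma is_basis_selects:
  assumes "is_basis f n k B"
  shows "is_basis f n k (\<lambda>z. {y \<in> cube n. selects (val (truth_table f n)) n (2 ^ k + val z) (val y)})"
proof -
  let ?T = "val (truth_table f n)"
  define F where "F = (LEAST F. basis_code ?T n k F)"
  from is_basis_code[OF assms] obtain F0 where F0: "F0 < 2 ^ (2 ^ Suc k * 2 ^ n)"
    "basis_code ?T n k F0" by blast
  have F: "basis_code ?T n k F" "\<And>F'. F' < F \<Longrightarrow> \<not> basis_code ?T n k F'"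
    unfolding F_def using LeastI[of _ F0] F0(2) not_less_Least by blast+
  have "F \<le> F0" unfolding F_def using F0(2) by (rule Least_le)
  then have bound: "F < 2 ^ (2 ^ Suc k * 2 ^ n)" using F0(1) by (rule le_less_trans)
  have sel: "selects ?T n v y \<longleftrightarrow> bit F (v * 2 ^ n + y)" if v: "2 ^ k \<le> v" "v < 2 ^ Suc k" for v y
  proof -
    have k: "k' = k" if "2 ^ k' \<le> v" "v < 2 ^ Suc k'" for k'
    proof -
      have "(2::nat) ^ k' < 2 ^ Suc k" "(2::nat) ^ k < 2 ^ Suc k'"
        using that v by (auto intro: le_less_trans)
      then have "k' < Suc k" "k < Suc k'" by (simp_all only: power_strict_increasing_iff)
      then show ?thesis by simp
    qed
    have F_eq: "F' = F" if "basis_code ?T n k F'" "\<forall>F''<F'. \<not> basis_code ?T n k F''" for F'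
      using that F by (meson linorder_neqE_nat)
    \<comment> \<open>Places \<open>k\<close> within the range of the bounded quantifier of
      \<open>selects\<close>.\<close>
    have "k < v" using v(1) less_exp[of k] by linarith
    then show ?thesis
      unfolding selects_def using k F_eq v F bound by blast
  qed
  show ?thesis
    unfolding is_basis_def
  proof (intro ballI)
    fix x y
    assume x: "x \<in> cube n" and "y \<in> Y1 f n x"
    then have y: "y \<in> cube n" "f n x y" by (auto simp: Y1_def)
    have less: "val x < 2 ^ n" "val y < 2 ^ n"
      using x y(1) val_less[of x] val_less[of y] by (simp_all add: cube_def)
    from F(1) less bit_truth_table[OF x y(1)] y(2) obtain d
      where d: "d < 2 ^ Suc k" "2 ^ k \<le> d" "bit F (d * 2 ^ n + val y)"
        "\<And>l. l < 2 ^ n \<Longrightarrow> bit F (d * 2 ^ n + l) \<Longrightarrow> bit ?T (val x * 2 ^ n + l)"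
      unfolding basis_code_def by blast
    from d(1,2) have "d - 2 ^ k < 2 ^ k" by simp
    then obtain z where z: "z \<in> cube k" "val z = d - 2 ^ k" using ex_val_eq by blast
    then have dz: "2 ^ k + val z = d" using d(2) by simp
    have "y' \<in> Y1 f n x" if "y' \<in> cube n" "selects ?T n d (val y')" for y'
    proof -
      have "val y' < 2 ^ n" using that(1) val_less[of y'] by (simp add: cube_def)
      then show ?thesis
        using that d(1,2,4) sel bit_truth_table[OF x that(1)] by (auto simp: Y1_def)
    qed
    then show "\<exists>z\<in>cube k. y \<in> {y \<in> cube n. selects ?T n (2 ^ k + val z) (val y)} \<and>
        {y \<in> cube n. selects ?T n (2 ^ k + val z) (val y)} \<subseteq> Y1 f n x"
      using y(1) d sel z(1) dz by (intro bexI[of _ z]) auto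
  qed
qed

lemma padded_eq_append: "length u \<le> m \<Longrightarrow> padded m u = u @ replicate (m - length u) False"
  by (rule nth_equalityI) (auto simp: padded_def nth_append)

lemma val_padded: "length u \<le> m \<Longrightarrow> val (padded m u) = val u"
  by (simp add: padded_eq_append horner_sum_append val_replicate_False)

text \<open>Both constants come from a single machine: \<open>j\<close> is its level, and
  \<open>c\<close> its code length plus one bit for the end marker.\<close>

lemma ic_yes_le:
  "\<exists>j c. \<forall>n k B x y. is_basis f n k B \<longrightarrow> k \<le> n \<longrightarrow> x \<in> cube n \<longrightarrow> y \<in> cube n \<longrightarrow>
     ic_yes f (growth j) n y (Y1 f n x) \<le> enat (k + c)"
proof -
  have "length (truth_table f n) \<le> 4 ^ n" for n
    by (simp add: length_truth_table flip: power_mult_distrib)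
  then obtain m where "realizes (truth_table f) m (\<lambda>s s'. \<forall>y d. s = (\<lambda>_. [])(0 := y, 1 := d) \<longrightarrow>
      s' 2 = (if selects (val (truth_table f (length y))) (length y)
        (val (padded (Suc (length y)) d)) (val y) then [True] else []))"
    by (rule realizes_selects)
  then obtain j where j: "realizes_at (truth_table f) j m
      (\<lambda>s s'. \<forall>y d. s = (\<lambda>_. [])(0 := y, 1 := d) \<longrightarrow>
      s' 2 = (if selects (val (truth_table f (length y))) (length y)
        (val (padded (Suc (length y)) d)) (val y) then [True] else []))"
    unfolding realizes_def by blast
  define ans where "ans d y = (if selects (val (truth_table f (length y))) (length y)
        (val (padded (Suc (length y)) d)) (val y) then Yes else Dont_know)" for d y
  have runs: "\<exists>k. runs f (code m @ d) y k (ans d y) \<and> k \<le> growth j (length y)" for d y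
  proof -
    let ?s = "(\<lambda>_. [])(0 := y, 1 := d) :: state"
    obtain k s' where *: "exec (truth_table f) m ?s k s'"
      "s' 2 = (if selects (val (truth_table f (length y))) (length y)
        (val (padded (Suc (length y)) d)) (val y) then [True] else [])"
      and bound: "\<And>m T. fits m ?s T \<Longrightarrow> fits (growth j m) s' (T + k)"
      by (rule realizes_atE[OF j, of ?s]) auto
    \<comment> \<open>The data sit in the exempt register, so the time bound depends on the input
      length only.\<close>
    have "fits (length y) ?s 0" by (simp add: fits_def)
    from bound[OF this] have "k \<le> growth j (length y)" by (simp add: fits_def)
    moreover have "runs f (code m @ d) y k (ans d y)"
      unfolding runs_def
      by (rule exI[of _ m], rule exI[of _ d], rule exI[of _ s'])
        (use * in \<open>auto simp: ans_def answer_of_def\<close>)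
    ultimately show ?thesis by blast
  qed
  then have outputs: "outputs f (code m @ d) y a \<longleftrightarrow> a = ans d y" for d y a
    unfolding outputs_def using runs_deterministic by metis
  have program: "ic_program f (growth j) n y A (code m @ d)"
    if "\<And>y'. y' \<in> cube n \<Longrightarrow> ans d y' = Yes \<Longrightarrow> y' \<in> A" "y \<in> A \<Longrightarrow> ans d y = Yes" for n y A d
  proof -
    have "\<exists>k a. runs f (code m @ d) y k a \<and> k \<le> growth j (length y)" for y
      using runs by blast
    then show ?thesis
      using that unfolding ic_program_def consistent_def outputs by (simp add: ans_def)
  qed
  have "ic_yes f (growth j) n y (Y1 f n x) \<le> enat (k + (length (code m) + 1))"
    if B: "is_basis f n k B" and k: "k \<le> n" and xy: "x \<in> cube n" "y \<in> cube n" for n k B x y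
  proof -
    have "\<exists>d. length d \<le> k + 1 \<and> ic_program f (growth j) n y (Y1 f n x) (code m @ d)"
    proof (cases "y \<in> Y1 f n x")
      case True
      with is_basis_selects[OF B] xy(1) obtain z where z: "z \<in> cube k"
        "selects (val (truth_table f n)) n (2 ^ k + val z) (val y)"
        "\<And>y'. y' \<in> cube n \<Longrightarrow> selects (val (truth_table f n)) n (2 ^ k + val z) (val y') \<Longrightarrow>
          y' \<in> Y1 f n x"
        unfolding is_basis_def by blast
      have "length z = k" using z(1) by (simp add: cube_def)
      \<comment> \<open>The final \<open>True\<close> is both the end marker and the summand
        \<open>2 ^ k\<close> that turns \<open>val z\<close> into an index.\<close>
      then have "val (padded (Suc n) (z @ [True])) = 2 ^ k + val z"
        using k by (simp add: val_padded horner_sum_append)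
      then have "ans (z @ [True]) y' =
          (if selects (val (truth_table f n)) n (2 ^ k + val z) (val y') then Yes else Dont_know)"
        if "y' \<in> cube n" for y'
        using that by (simp add: ans_def cube_def)
      then have "ic_program f (growth j) n y (Y1 f n x) (code m @ z @ [True])"
        using z(2,3) xy(2) by (intro program) (auto split: if_splits)
      then show ?thesis using \<open>length z = k\<close> by (intro exI[of _ "z @ [True]"]) simp
    next
      case False
      \<comment> \<open>Empty data have value 0, and no \<open>k < 0\<close> exists; the program
        never commits itself and is consistent with every set.\<close>
      have "ans [] y' = Dont_know" for y'
        by (simp add: ans_def val_padded selects_def)
      then have "ic_program f (growth j) n y (Y1 f n x) (code m @ [])"
        using False by (intro program) auto
      then show ?thesis by (intro exI[of _ "[]"]) simp
    qed
    then obtain d where "length d \<le> k + 1" and d: "ic_program f (growth j) n y (Y1 f n x) (code m @ d)"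
      by blast
    have "ic_yes f (growth j) n y (Y1 f n x) \<le> enat (length (code m @ d))"
      unfolding ic_yes_def using d by (intro Inf_lower) blast
    also have "\<dots> \<le> enat (k + (length (code m) + 1))" using \<open>length d \<le> k + 1\<close> by simp
    finally show ?thesis .
  qed
  then show ?thesis by blast
qed

section \<open>Protocols\<close>

lemma finite_cube: "finite (cube n)"
  using finite_lists_length_eq[of "UNIV :: bool set" n] by (simp add: cube_def)

text \<open>The rectangle property. Both runs read their branches off the same \<open>z\<close>, so
  they follow one path, and the run on the crossed pair follows it too. Prefixes instead of equality
  allow for padding.\<close>

lemma exchange_output_cross:
  assumes "prefix (exchange_bits E x y) z" "prefix (exchange_bits E x' y') z"
    and "exchange_output E x' y'"
  shows "exchange_output E x y'"
  using assms
proof (induction E arbitrary: z)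
  case (Alice g T F)
  then show ?case by (cases z) (auto split: if_splits)
next
  case (Bob g T F)
  then show ?case by (cases z) (auto split: if_splits)
qed simp

lemma ex_basis_N1: "\<exists>B. is_basis f n (N1 f n) B"
proof -
  have "N1 f n \<in> {protocol_cost P f n | P. is_protocol_for P f n}"
    unfolding N1_def using protocol_exists[of f n] by (intro Inf_nat_def1) blast
  then obtain P where P: "is_protocol_for P f n" "N1 f n = protocol_cost P f n" by blast
  have conv: "\<exists>w\<in>guesses P. accepts P w x y \<and> length (conversation P w x y) \<le> N1 f n"
    if "x \<in> cube n" "y \<in> cube n" "f n x y" for x y
  proof -
    have "pair_cost P x y \<in> {length (conversation P w x y) | w. w \<in> guesses P \<and> accepts P w x y}"
      unfolding pair_cost_def using P(1) that
      by (intro Inf_nat_def1) (auto simp: is_protocol_for_def)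
    then obtain w where w: "w \<in> guesses P" "accepts P w x y"
      "length (conversation P w x y) = pair_cost P x y" by auto
    \<comment> \<open>Finiteness is needed because \<open>Sup\<close> on \<open>nat\<close> is an
      upper bound only for bounded sets.\<close>
    have "{pair_cost P x y | x y. x \<in> cube n \<and> y \<in> cube n \<and> f n x y} \<subseteq>
        (\<lambda>(x, y). pair_cost P x y) ` (cube n \<times> cube n)" by auto
    then have "finite {pair_cost P x y | x y. x \<in> cube n \<and> y \<in> cube n \<and> f n x y}"
      using finite_cube by (meson finite_SigmaI finite_imageI finite_subset)
    then have "pair_cost P x y \<le> N1 f n"
      unfolding P(2) protocol_cost_def using that
      by (intro cSup_upper bdd_above_finite) auto
    with w show ?thesis by auto
  qed
  \<comment> \<open>The columns of all accepting runs whose conversation starts \<open>z\<close>;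
    the row \<open>x\<close> may vary.\<close>
  define B where "B z = {y \<in> cube n. \<exists>w\<in>guesses P. \<exists>x\<in>cube n.
    accepts P w x y \<and> prefix (conversation P w x y) z}" for z
  have "\<exists>z\<in>cube (N1 f n). y \<in> B z \<and> B z \<subseteq> Y1 f n x" if x: "x \<in> cube n" and "y \<in> Y1 f n x" for x y
  proof -
    from that have y: "y \<in> cube n" "f n x y" by (auto simp: Y1_def)
    from conv[OF x this] obtain w where w: "w \<in> guesses P" "accepts P w x y"
      "length (conversation P w x y) \<le> N1 f n" by blast
    define z where
      "z = conversation P w x y @ replicate (N1 f n - length (conversation P w x y)) False"
    have z: "prefix (w @ exchange_bits (exch P w) x y) z"
      by (simp add: z_def conversation_def)
    have "y' \<in> Y1 f n x" if "y' \<in> B z" for y'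
    proof -
      from that obtain w' x' where y': "y' \<in> cube n" and w': "w' \<in> guesses P" "x' \<in> cube n"
        "accepts P w' x' y'" "prefix (w' @ exchange_bits (exch P w') x' y') z"
        unfolding B_def conversation_def by blast
      \<comment> \<open>Two guesses that start the same string coincide by prefix-freeness, so both
        runs use the same exchange tree.\<close>
      have "prefix w z" "prefix w' z" using z w'(4) append_prefixD by blast+
      then have "prefix w w' \<or> prefix w' w" using prefix_same_cases by blast
      then have "w' = w"
        using w(1) w'(1) P(1) by (auto simp: is_protocol_for_def prefix_free_def)
      obtain z' where "z = w @ z'" using \<open>prefix w z\<close> by (auto simp: prefix_def)
      then have "exchange_output (exch P w) x y'"
        using exchange_output_cross[of "exch P w" x y z' x' y'] z w'(3,4)
        by (simp add: \<open>w' = w\<close> accepts_def)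
      then have "f n x y'"
        using P(1) x y' w(1) by (auto simp: is_protocol_for_def accepts_def)
      with y' show ?thesis by (simp add: Y1_def)
    qed
    moreover have "z \<in> cube (N1 f n)" using w(3) by (simp add: z_def cube_def)
    moreover have "y \<in> B z"
      using w x y(1) z by (fastforce simp: B_def conversation_def)
    ultimately show ?thesis by blast
  qed
  then show ?thesis unfolding is_basis_def by blast
qed

text \<open>The cost is \<open>m + 1\<close> bits for the guess and one confirming bit from each
  player. Alice knows \<open>Y1 f n x\<close> and so can judge consistency; Bob knows
  \<open>y\<close>. A consistent program that accepts \<open>y\<close> proves
  \<open>f n x y\<close>.\<close>

lemma N1_le_of_ic_yes_le:
  assumes "\<And>x y. x \<in> cube n \<Longrightarrow> y \<in> cube n \<Longrightarrow> ic_yes f t n y (Y1 f n x) \<le> enat m"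
  shows "N1 f n \<le> m + 3"
proof -
  \<comment> \<open>Decodes a program padded on the left by zeros and a separating 1.\<close>
  define dec :: "bool list \<Rightarrow> bool list" where "dec w = tl (dropWhile Not w)" for w
  define P where "P = \<lparr>guesses = cube (Suc m), exch = (\<lambda>w.
    Alice (\<lambda>x. consistent f n (dec w) (Y1 f n x))
      (Bob (\<lambda>y. outputs f (dec w) y Yes) (Output True) (Output False)) (Output False))\<rparr>"
  have accepts: "accepts P w x y \<longleftrightarrow> consistent f n (dec w) (Y1 f n x) \<and> outputs f (dec w) y Yes"
    for w x y by (simp add: P_def accepts_def)
  have len: "length (conversation P w x y) = m + 3" if "w \<in> guesses P" "accepts P w x y" for w x y
    using that by (simp add: accepts) (simp add: P_def conversation_def cube_def)
  have guess: "\<exists>w\<in>guesses P. accepts P w x y"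
    if xy: "x \<in> cube n" "y \<in> cube n" "f n x y" for x y
  proof -
    let ?L = "{enat (length p) | p. ic_program f t n y (Y1 f n x) p}"
    have "Inf ?L \<le> enat m" using assms[OF xy(1,2)] by (simp add: ic_yes_def)
    \<comment> \<open>A finite infimum excludes the empty set, so it is attained by some
      program.\<close>
    then have "Inf ?L \<noteq> \<infinity>" using infinity_ileE by metis
    then have "?L \<noteq> {}" by (metis Inf_enat_def)
    then have "Inf ?L \<in> ?L" by (auto simp: Inf_enat_def intro: LeastI)
    then obtain p where p: "ic_program f t n y (Y1 f n x) p" "enat (length p) \<le> enat m"
      using \<open>Inf ?L \<le> enat m\<close> by auto
    let ?w = "replicate (m - length p) False @ True # p"
    have "?w \<in> guesses P" using p(2) by (simp add: P_def cube_def)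
    moreover have "dec ?w = p" by (simp add: dec_def dropWhile_append)
    ultimately show ?thesis
      using p(1) xy by (intro bexI[of _ ?w]) (auto simp: accepts ic_program_def Y1_def)
  qed
  have "is_protocol_for P f n"
    unfolding is_protocol_for_def
  proof (intro conjI ballI impI notI)
    show "prefix_free (guesses P)"
      by (auto simp: prefix_free_def P_def cube_def prefix_def)
    show False if "x \<in> cube n" "y \<in> cube n" "\<not> f n x y" "accepts P w x y" for x y w
      using that by (auto simp: accepts consistent_def Y1_def)
  qed (rule guess)
  then have "N1 f n \<le> protocol_cost P f n"
    unfolding N1_def by (intro cInf_lower) auto
  also have "\<dots> \<le> m + 3"
  proof -
    have "pair_cost P x y \<le> m + 3" if xy: "x \<in> cube n" "y \<in> cube n" "f n x y" for x y
    proof -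
      from guess[OF xy] obtain w where w: "w \<in> guesses P" "accepts P w x y" by blast
      have "pair_cost P x y \<le> length (conversation P w x y)"
        unfolding pair_cost_def using w by (intro cInf_lower) auto
      then show ?thesis using len[OF w] by simp
    qed
    \<comment> \<open>When no pair has value 1, the supremum of the empty set is 0.\<close>
    then show ?thesis
      unfolding protocol_cost_def
      by (cases "{pair_cost P x y | x y. x \<in> cube n \<and> y \<in> cube n \<and> f n x y} = {}")
        (simp add: Sup_nat_def, rule cSup_least, auto)
  qed
  finally show ?thesis .
qed

theorem mainTheorem1:
  fixes f :: "nat \<Rightarrow> bool list \<Rightarrow> bool list \<Rightarrow> bool"
  shows "\<exists>(t :: nat \<Rightarrow> nat) (c :: nat). computable t \<and>
    (\<forall>n. \<bar>ereal (real (N1 f n)) -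
          ereal_of_enat (Max {ic_yes f t n y (Y1 f n x) | x y. x \<in> cube n \<and> y \<in> cube n})\<bar>
        \<le> ereal (real c))"
proof -
  obtain j c where ic: "\<And>n k B x y. is_basis f n k B \<Longrightarrow> k \<le> n \<Longrightarrow> x \<in> cube n \<Longrightarrow> y \<in> cube n \<Longrightarrow>
      ic_yes f (growth j) n y (Y1 f n x) \<le> enat (k + c)"
    using ic_yes_le[of f] that by (elim exE) blast
  have "\<bar>ereal (real (N1 f n)) - ereal_of_enat
      (Max {ic_yes f (growth j) n y (Y1 f n x) | x y. x \<in> cube n \<and> y \<in> cube n})\<bar>
    \<le> ereal (real (c + 3))" for n
  proof -
    let ?S = "{ic_yes f (growth j) n y (Y1 f n x) | x y. x \<in> cube n \<and> y \<in> cube n}"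
    have "?S = (\<lambda>(x, y). ic_yes f (growth j) n y (Y1 f n x)) ` (cube n \<times> cube n)" by auto
    then have fin: "finite ?S" using finite_cube by simp
    have "replicate n False \<in> cube n" by (simp add: cube_def)
    then have ne: "?S \<noteq> {}" by blast
    \<comment> \<open>The machine reads only \<open>n + 1\<close> bits of its data, so the exponent must not exceed \<open>n\<close>.\<close>
    have "\<exists>B. is_basis f n (min n (N1 f n)) B"
      \<comment> \<open>If \<open>N1 f n\<close> exceeds \<open>n\<close>, the sets
        \<open>Y1 f n x\<close> themselves, indexed by \<open>x\<close>, serve as basis.\<close>
      using ex_basis_N1[of f n] is_basis_Y1[of f n] by (cases "n \<le> N1 f n") auto
    then obtain B where "is_basis f n (min n (N1 f n)) B" by blast
    from ic[OF this] have "Max ?S \<le> enat (min n (N1 f n) + c)"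
      using fin ne by auto
    then obtain m where m: "Max ?S = enat m" "m \<le> min n (N1 f n) + c"
      using enat_ile by fastforce
    have "N1 f n \<le> m + 3"
    proof (rule N1_le_of_ic_yes_le)
      show "ic_yes f (growth j) n y (Y1 f n x) \<le> enat m" if "x \<in> cube n" "y \<in> cube n" for x y
        unfolding m(1)[symmetric] using fin that by (intro Max_ge) auto
    qed
    with m show ?thesis by auto
  qed
  with computable_growth[of j] show ?thesis by blast
qed

end
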